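(* Let $d\ge2$ be an integer and let $Bes_d(t)$ be the $d$-dimensional Bessel process. Let $0<s_1<s_2$ and let $x_1,x_2\to+\infty$ so that $\sqrt{\frac{s_1}{s_2}}\,\frac{x_2}{x_1}=\rho$ is constant and $1<\frac{x_2}{x_1}<\frac{s_2}{s_1}$. Then $$P(Bes_d(s_1)\ge x_1,\ Bes_d(s_2)\ge x_2)=\frac{(x_1^* )^{\frac{d-3}2}\left(\frac\rho{2c}\right)^{\frac{d-1}2}(1-c^2)^{\frac32}\,e^{-\frac{x_1^*}{2(1-c^2)}(\rho^2-2c\rho+1)}}{\sqrt\pi\,\Gamma(\frac d2)(\rho-c)(1-c\rho)}\cdot\left(1+O\left(\frac{\ln x_1^*}{x_1^*}\right)\right),$$ where $x_1^*:=\frac{x_1^2}{s_1}$ and $c:=\sqrt{\frac{s_1}{s_2}}$.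
   Context: The $d$-dimensional Bessel process $Bes_d(t)$ is the Euclidean norm of a standard $d$-dimensional Brownian motion (started at the origin). The parameters $d,s_1,s_2,\rho$ are fixed in the asymptotics. *)

theory Defs
  imports "HOL-Probability.Probability" "HOL-Library.Landau_Symbols"
begin

text \<open>
  The dimension of the Brownian motion is that of its state space, \<open>DIM('a)\<close>. The increment over
  \<open>[s, t]\<close> has the centred Gaussian law with covariance \<open>(t - s)\<close> times the identity, whose density is
  a product over an orthonormal basis; \<^const>\<open>normal_density\<close> takes the standard deviation, not the
  variance.
\<close>

locale standard_brownian_motion = prob_space M
  for M :: "'w measure" +
  fixes B :: "real \<Rightarrow> 'w \<Rightarrow> 'a::euclidean_space"
  assumes measurable: "\<And>t. 0 \<le> t \<Longrightarrow> random_variable borel (B t)"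
    and start: "AE \<omega> in M. B 0 \<omega> = 0"
    and continuous_paths: "AE \<omega> in M. continuous_on {0..} (\<lambda>t. B t \<omega>)"
    and independent_increments:
      "\<And>(n::nat) t. 0 \<le> t 0 \<Longrightarrow> (\<And>i. i < n \<Longrightarrow> t i \<le> t (Suc i)) \<Longrightarrow>
        indep_vars (\<lambda>_. borel) (\<lambda>i \<omega>. B (t (Suc i)) \<omega> - B (t i) \<omega>) {..<n}"
    and gaussian_increments:
      "\<And>s t. 0 \<le> s \<Longrightarrow> s < t \<Longrightarrow>
        distributed M lborel (\<lambda>\<omega>. B t \<omega> - B s \<omega>)
          (\<lambda>x. ennreal (\<Prod>b\<in>Basis. normal_density 0 (sqrt (t - s)) (x \<bullet> b)))"

definition bessel :: "(real \<Rightarrow> 'w \<Rightarrow> 'a::euclidean_space) \<Rightarrow> real \<Rightarrow> 'w \<Rightarrow> real" where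
  "bessel B t \<omega> = norm (B t \<omega>)"

end

theory Submission
  imports Defs
begin

text \<open>
  Write \<open>R = x1\<close>, \<open>l = x2 / x1\<close> (a constant with \<open>1 < l < s2 / s1\<close>), \<open>d = DIM('a)\<close> and
  \<open>m = (d - 1) / 2\<close>. Independence of the increments gives \<open>(B s1, B s2)\<close> a Gaussian density that
  depends on \<open>(x, y)\<close> only through \<open>|x|\<close>, \<open>|y|\<close> and \<open>x \<bullet> y\<close>. Integrating out all directions leaves
  a double integral over the radii \<open>u \<ge> R\<close>, \<open>v \<ge> l R\<close> whose integrand is, up to a constant,
  \<open>(u v)\<^bsup>d-1\<^esup> exp (- (a u\<^sup>2 + b v\<^sup>2) / 2 + \<kappa> u v) \<Lambda>(\<kappa> u v)\<close>. Here \<open>\<Lambda>(z) = scaled_bessel (m - 1) z\<close> is the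
  integral of \<open>(s (2 - s))\<^bsup>m-1\<^esup> exp (- z s)\<close> over \<open>0 < s < 2\<close>, and the constants are
  \<open>a = 1/s1 + 1/(s2 - s1)\<close> and \<open>b = \<kappa> = 1/(s2 - s1)\<close>. Up to elementary factors \<open>\<Lambda>\<close> is a modified
  Bessel function; it is kept as an integral because only its behaviour for large \<open>z\<close> matters.

  Two estimates then give the result, both with relative error \<open>O(1/R\<^sup>2)\<close>, which is stronger than the
  claimed \<open>O(ln x / x)\<close> for \<open>x = R\<^sup>2 / s1\<close>.

  \<^item> \<open>\<Lambda>(z) = 2\<^sup>m\<^sup>-\<^sup>1 \<Gamma>(m) z\<^sup>-\<^sup>m (1 + O(1/z))\<close> (Watson's lemma at \<open>s = 0\<close>). On the region of integration
    \<open>z = \<kappa> u v\<close> is at least \<open>\<kappa> l R\<^sup>2\<close>, so the error is uniformly \<open>O(1/R\<^sup>2)\<close>. This is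
    \<open>scaled_bessel_lower\<close> and \<open>scaled_bessel_upper\<close>.

  \<^item> What remains is the integral of \<open>(uv)\<^sup>m\<close> times the exponential of a negative definite quadratic
    form over a quadrant. The condition \<open>1 < l < s2 / s1\<close> says precisely that the exponent decreases
    strictly in both coordinate directions at the corner \<open>(R, l R)\<close>, at rates proportional to \<open>R\<close>. Hence the corner
    dominates (Laplace's method at a corner) and the integral is, to leading order, the value of the integrand
    there divided by the product of the two rates: \<open>corner_integral_lower\<close> and \<open>corner_integral_upper\<close>.

  The directions are integrated out with two facts about Lebesgue measure: the radial part of
  an integral is determined by volumes of balls (\<open>nn_integral_radial\<close>), and Lebesgue measure is invariant
  under orthogonal maps, so that in the integral over \<open>y\<close> the direction of \<open>x\<close> may be taken to be a basis vector
  (\<open>nn_integral_norm_inner_cong\<close>, \<open>nn_integral_axial\<close>).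
\<close>

section \<open>Radial integration and rotation invariance\<close>

text \<open>
  The hypothesis gives the distribution function of \<open>N\<close>, and a measure on the line is determined by its
  values on the half-lines \<open>{..r}\<close>. It is used for the norm of the whole space and for the distance to an axis.
\<close>

lemma nn_integral_radial:
  fixes N :: "'b \<Rightarrow> real" and h :: "real \<Rightarrow> ennreal"
  assumes N [measurable]: "N \<in> borel_measurable M" and nonneg: "\<And>x. x \<in> space M \<Longrightarrow> 0 \<le> N x"
    and vol: "\<And>r. 0 < r \<Longrightarrow> emeasure M {x \<in> space M. N x \<le> r} = ennreal (V * r ^ n)"
    and "0 < n" "0 \<le> V"
    and h [measurable]: "h \<in> borel_measurable borel"
  shows "(\<integral>\<^sup>+x. h (N x) \<partial>M) = ennreal (real n * V) * (\<integral>\<^sup>+t. indicator {0<..} t * ennreal (t ^ (n - 1)) * h t \<partial>lborel)"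
proof -
  define D where "D = density lborel (\<lambda>t. ennreal (real n * V) * (indicator {0<..} t * ennreal (t ^ (n - 1))))"
  \<comment> \<open>the hypothesis covers positive radii only, so the set where N vanishes is treated as a limit\<close>
  have vol0: "emeasure M {x \<in> space M. N x \<le> 0} = 0"
  proof -
    have le: "emeasure M {x \<in> space M. N x \<le> 0} \<le> ennreal (V * r ^ n)" if "0 < r" for r
      unfolding vol[OF that, symmetric] using that by (intro emeasure_mono) auto
    have "((\<lambda>r. ennreal (V * r ^ n)) \<longlongrightarrow> ennreal (V * 0 ^ n)) (at_right 0)"
      by (intro tendsto_intros)
    moreover have "eventually (\<lambda>r. emeasure M {x \<in> space M. N x \<le> 0} \<le> ennreal (V * r ^ n)) (at_right 0)"
      using le eventually_at_right_less[of 0] by (auto elim: eventually_mono)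
    ultimately have "emeasure M {x \<in> space M. N x \<le> 0} \<le> ennreal (V * 0 ^ n)"
      by (intro tendsto_lowerbound) auto
    then show ?thesis using \<open>0 < n\<close> by (simp add: power_0_left)
  qed
  have eqr: "emeasure (distr M borel N) {..r} = emeasure D {..r}" for r
  proof -
    have "emeasure (distr M borel N) {..r} = emeasure M {x \<in> space M. N x \<le> r}"
      by (subst emeasure_distr) (auto intro!: arg_cong[where f="emeasure M"])
    moreover have "emeasure D {..r} = (\<integral>\<^sup>+t. ennreal (real n * V * t ^ (n - 1)) * indicator {0..r} t \<partial>lborel)"
      unfolding D_def by (subst emeasure_density)
        (auto intro!: nn_integral_cong_AE AE_I[of _ _ "{0}"] simp: indicator_def of_bool_def ennreal_mult' \<open>0 \<le> V\<close> split: if_splits)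
    moreover have "emeasure M {x \<in> space M. N x \<le> r} = (\<integral>\<^sup>+t. ennreal (real n * V * t ^ (n - 1)) * indicator {0..r} t \<partial>lborel)"
    proof (cases "0 < r")
      case True
      have "(\<integral>\<^sup>+t. ennreal (real n * V * t ^ (n - 1)) * indicator {0..r} t \<partial>lborel) = ennreal (V * r ^ n - V * 0 ^ n)"
        using True \<open>0 \<le> V\<close> by (intro nn_integral_FTC_Icc) (auto intro!: derivative_eq_intros)
      then show ?thesis using vol[OF True] \<open>0 < n\<close> by (simp add: power_0_left)
    next
      case False
      have "emeasure M {x \<in> space M. N x \<le> r} \<le> emeasure M {x \<in> space M. N x \<le> 0}"
        using False by (intro emeasure_mono) auto
      moreover have "(\<integral>\<^sup>+t. ennreal (real n * V * t ^ (n - 1)) * indicator {0..r} t \<partial>lborel) = (\<integral>\<^sup>+(t::real). 0 \<partial>lborel)"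
        using False by (intro nn_integral_cong_AE AE_I[of _ _ "{0}"]) (auto simp: indicator_def split: if_splits)
      ultimately show ?thesis using vol0 by simp
    qed
    ultimately show ?thesis by simp
  qed
  have "distr M borel N = D"
  proof (rule measure_eqI_generator_eq[where E="range (\<lambda>r. {..r})" and A="\<lambda>i. {..real i}" and \<Omega>=UNIV])
    show "Int_stable (range (\<lambda>r::real. {..r}))"
      by (auto simp: Int_stable_def)
    show "sets (distr M borel N) = sigma_sets UNIV (range (\<lambda>r. {..r}))"
      by (simp add: borel_eq_atMost)
    show "sets D = sigma_sets UNIV (range (\<lambda>r. {..r}))"
      by (simp add: D_def borel_eq_atMost)
    show "(\<Union>i. {..real i}) = UNIV" 
      by (auto intro: real_arch_simple)
    show "emeasure (distr M borel N) {..real i} \<noteq> \<infinity>" for i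
    proof -
      have "emeasure (distr M borel N) {..real i} = emeasure M {x \<in> space M. N x \<le> real i}"
        by (subst emeasure_distr) (auto intro!: arg_cong[where f="emeasure M"])
      then show ?thesis using vol0 vol[of "real i"] by (cases i) auto
    qed
  qed (auto simp: eqr)
  have "(\<integral>\<^sup>+x. h (N x) \<partial>M) = (\<integral>\<^sup>+t. h t \<partial>distr M borel N)"
    by (simp add: nn_integral_distr)
  also have "\<dots> = (\<integral>\<^sup>+t. ennreal (real n * V) * (indicator {0<..} t * ennreal (t ^ (n - 1)) * h t) \<partial>lborel)"
    unfolding \<open>distr M borel N = D\<close> unfolding D_def
    by (simp add: nn_integral_density mult.assoc)
  finally show ?thesis by (simp add: nn_integral_cmult)
qed

text \<open>
  Uniqueness of Haar measure by the classical Fubini argument: evaluating the double integral of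
  \<open>1\<^sub>U(x) 1\<^sub>B(x + y)\<close> in both orders, with translation invariance of one measure each time, gives
  \<open>\<nu>(U) \<lambda>(B) = \<nu>(B) \<lambda>(-U)\<close>. For the unit ball \<open>U = -U\<close>, and both measures agree on it.
\<close>

lemma translation_invariant_eq_lborel:
  fixes \<nu> :: "'a::euclidean_space measure"
  assumes [measurable_cong, simp]: "sets \<nu> = sets borel" and "sigma_finite_measure \<nu>"
    and shift: "\<And>a. distr \<nu> borel (\<lambda>x. a + x) = \<nu>"
    and ball: "emeasure \<nu> (ball 0 1) = emeasure lborel (ball (0::'a) 1)"
  shows "\<nu> = lborel"
proof -
  interpret \<nu>: sigma_finite_measure \<nu> by fact
  interpret P: pair_sigma_finite \<nu> "lborel :: 'a measure" ..
  have [simp]: "space \<nu> = UNIV" using sets_eq_imp_space_eq[of \<nu> borel] by simp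
  define U where "U = ball (0::'a) 1"
  have U: "U \<in> sets borel" and U': "-x \<in> U \<longleftrightarrow> x \<in> U" for x by (auto simp: U_def)
  note [measurable] = U
  have U_pos: "emeasure lborel U \<noteq> 0" and U_fin: "emeasure lborel U \<noteq> \<infinity>"
    using unit_ball_vol_pos[of "real DIM('a)", THEN less_imp_neq] unfolding U_def by (auto simp: emeasure_ball)
  have "emeasure \<nu> B = emeasure lborel B" if [measurable]: "B \<in> sets borel" for B
  proof -
    have "emeasure \<nu> U * emeasure lborel B = (\<integral>\<^sup>+x. \<integral>\<^sup>+y. indicator U x * indicator B y \<partial>lborel \<partial>\<nu>)"
      by (simp add: nn_integral_cmult nn_integral_multc)
    also have "\<dots> = (\<integral>\<^sup>+x. \<integral>\<^sup>+y. indicator U x * indicator B (x + y) \<partial>lborel \<partial>\<nu>)"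
    proof (rule nn_integral_cong)
      fix x :: 'a
      have "(\<integral>\<^sup>+y. indicator U x * indicator B y \<partial>lborel) = (\<integral>\<^sup>+y. indicator U x * indicator B y \<partial>distr lborel borel ((+) x))"
        by (simp add: lborel_distr_plus)
      then show "(\<integral>\<^sup>+y. indicator U x * indicator B y \<partial>lborel) = (\<integral>\<^sup>+y. indicator U x * indicator B (x + y) \<partial>lborel)"
        by (simp add: nn_integral_distr)
    qed
    also have "\<dots> = (\<integral>\<^sup>+y. \<integral>\<^sup>+x. indicator U x * indicator B (x + y) \<partial>\<nu> \<partial>lborel)"
      by (rule P.Fubini'[symmetric]) simp
    also have "\<dots> = (\<integral>\<^sup>+y. \<integral>\<^sup>+x. indicator U (x - y) * indicator B x \<partial>\<nu> \<partial>lborel)"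
    proof (rule nn_integral_cong)
      fix y :: 'a
      have "(\<integral>\<^sup>+x. indicator U x * indicator B (x + y) \<partial>\<nu>) = (\<integral>\<^sup>+x. indicator U x * indicator B (x + y) \<partial>distr \<nu> borel (\<lambda>x. - y + x))"
        by (simp only: shift)
      also have "\<dots> = (\<integral>\<^sup>+x. indicator U (-y + x) * indicator B (-y + x + y) \<partial>\<nu>)"
        by (subst nn_integral_distr) simp_all
      finally show "(\<integral>\<^sup>+x. indicator U x * indicator B (x + y) \<partial>\<nu>) = (\<integral>\<^sup>+x. indicator U (x - y) * indicator B x \<partial>\<nu>)"
        by simp
    qed
    also have "\<dots> = (\<integral>\<^sup>+x. \<integral>\<^sup>+y. indicator U (x - y) * indicator B x \<partial>lborel \<partial>\<nu>)"
      by (rule P.Fubini') simp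
    also have "\<dots> = (\<integral>\<^sup>+x. \<integral>\<^sup>+y. indicator U (y - x) * indicator B x \<partial>lborel \<partial>\<nu>)"
      using U' by (intro nn_integral_cong) (metis (no_types, lifting) indicator_simps minus_diff_eq)
    also have "\<dots> = (\<integral>\<^sup>+x. \<integral>\<^sup>+y. indicator U y * indicator B x \<partial>lborel \<partial>\<nu>)"
    proof (rule nn_integral_cong)
      fix x :: 'a
      have "(\<integral>\<^sup>+y. indicator U (y - x) * indicator B x \<partial>lborel) = (\<integral>\<^sup>+y. indicator U (y - x) * indicator B x \<partial>distr lborel borel ((+) x))"
        by (simp add: lborel_distr_plus)
      then show "(\<integral>\<^sup>+y. indicator U (y - x) * indicator B x \<partial>lborel) = (\<integral>\<^sup>+y. indicator U y * indicator B x \<partial>lborel)"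
        by (simp add: nn_integral_distr)
    qed
    also have "\<dots> = emeasure \<nu> B * emeasure lborel U"
      by (simp add: nn_integral_cmult nn_integral_multc mult.commute)
    finally have "emeasure lborel U * emeasure lborel B = emeasure lborel U * emeasure \<nu> B"
      using ball by (simp add: U_def mult.commute)
    with U_pos U_fin show ?thesis by (simp add: ennreal_mult_cancel_left)
  qed
  then show ?thesis by (intro measure_eqI) auto
qed

text \<open>
  The image measure is again translation invariant, because an orthogonal map is linear and onto, and
  it has the same value on the unit ball, which the map preserves.
\<close>

lemma lborel_distr_orthogonal_transformation:
  fixes f :: "'a::euclidean_space \<Rightarrow> 'a"
  assumes f: "orthogonal_transformation f"
  shows "distr lborel borel f = lborel"
proof (rule translation_invariant_eq_lborel)
  have lin: "linear f" and nf: "norm (f x) = norm x" for x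
    using f by (auto simp: orthogonal_transformation)
  then have [measurable]: "f \<in> borel_measurable borel"
    by (intro borel_measurable_continuous_onI linear_continuous_on linear_conv_bounded_linear[THEN iffD1])
  have ball: "emeasure (distr lborel borel f) (ball 0 r) = emeasure lborel (ball (0::'a) r)" for r
    by (subst emeasure_distr) (auto intro!: arg_cong[where f="emeasure lborel"] simp: nf)
  show "sigma_finite_measure (distr lborel borel f)"
  proof
    show "\<exists>A. countable A \<and> A \<subseteq> sets (distr lborel borel f) \<and> \<Union>A = space (distr lborel borel f) \<and>
        (\<forall>a\<in>A. emeasure (distr lborel borel f) a \<noteq> \<infinity>)"
      by (intro exI[of _ "range (\<lambda>n::nat. ball 0 (real n))"])
         (auto simp: ball emeasure_ball reals_Archimedean2)
  qed
  show "distr (distr lborel borel f) borel (\<lambda>x. a + x) = distr lborel borel f" for a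
  proof -
    obtain b where b: "a = f b"
      using orthogonal_transformation_surj[OF f] by (auto simp: surj_def)
    have "distr (distr lborel borel f) borel (\<lambda>x. a + x) = distr lborel borel ((\<lambda>x. f b + f x))"
      by (subst distr_distr) (auto simp: b comp_def)
    also have "\<dots> = distr lborel borel (f \<circ> (\<lambda>x. b + x))"
      by (simp add: linear_add[OF lin] comp_def)
    also have "\<dots> = distr (distr lborel borel (\<lambda>x. b + x)) borel f"
      by (subst distr_distr) auto
    also have "distr lborel borel (\<lambda>x. b + x) = lborel"
      by (rule lborel_distr_plus)
    finally show ?thesis .
  qed
  show "emeasure (distr lborel borel f) (ball 0 1) = emeasure lborel (ball (0::'a) 1)" by (rule ball)
qed simp

lemma exists_orthogonal_transformation_mapping:
  fixes e x :: "'a::euclidean_space"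
  assumes "norm e = norm x"
  obtains f where "orthogonal_transformation f" "f e = x"
proof (cases "e = x")
  case True
  then show thesis using that[of "\<lambda>x. x"] by simp
next
  case False
  \<comment> \<open>the reflection in the hyperplane orthogonal to the difference of the two vectors\<close>
  define h where "h = e - x"
  define f where "f y = y - (2 * (h \<bullet> y) / (h \<bullet> h)) *\<^sub>R h" for y
  have h: "h \<bullet> h \<noteq> 0" using False by (simp add: h_def)
  have "linear f"
    by (auto intro!: linearI simp: f_def algebra_simps inner_right_distrib add_divide_distrib)
  moreover have "norm (f v) = norm v" for v
    unfolding norm_eq using h by (simp add: f_def inner_diff_left inner_diff_right inner_commute field_simps)
  moreover have "f e = x"
  proof -
    have "e \<bullet> e = x \<bullet> x" using assms by (simp add: norm_eq)
    then have "2 * (h \<bullet> e) = h \<bullet> h" by (simp add: h_def inner_diff_left inner_diff_right inner_commute)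
    then show ?thesis using h by (simp add: f_def) (simp add: h_def)
  qed
  ultimately show thesis using that orthogonal_transformation by blast
qed

section \<open>Spherical coordinates around an axis\<close>

text \<open>
  The substitution \<open>v = sqrt (a\<^sup>2 + w\<^sup>2)\<close>, from the distance \<open>w\<close> to an axis to the distance \<open>v\<close> to the origin at
  height \<open>a\<close> along the axis. For \<open>n = 0\<close> the new integrand is singular at \<open>v = \<bar>a\<bar>\<close>,
  but the substituted function itself is smooth, so the change of variables on bounded intervals still applies.
\<close>

lemma nn_integral_substitution_hypot:
  fixes h :: "real \<Rightarrow> ennreal" and a :: real
  assumes [measurable]: "h \<in> borel_measurable borel" and "a \<noteq> 0"
  shows "(\<integral>\<^sup>+w. indicator {0<..} w * ennreal (w ^ n) * h (sqrt (a\<^sup>2 + w\<^sup>2)) \<partial>lborel)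
       = (\<integral>\<^sup>+v. indicator {\<bar>a\<bar><..} v * ennreal (v * (v\<^sup>2 - a\<^sup>2) powr ((real n - 1) / 2)) * h v \<partial>lborel)"
proof -
  define G where "G w = sqrt (a\<^sup>2 + w\<^sup>2)" for w
  define H where "H v = ennreal (v * (v\<^sup>2 - a\<^sup>2) powr ((real n - 1) / 2)) * h v" for v
  have [measurable]: "H \<in> borel_measurable borel" unfolding H_def by simp
  have apos: "0 < a\<^sup>2 + w\<^sup>2" for w using \<open>a \<noteq> 0\<close> by (simp add: add_pos_nonneg)
  then have Gpos: "0 < G w" for w by (simp add: G_def)
  have G0: "G 0 = \<bar>a\<bar>" by (simp add: G_def)
  have bounded: "(\<integral>\<^sup>+v. H v * indicator {\<bar>a\<bar>..G (real N)} v \<partial>lborel)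
      = (\<integral>\<^sup>+w. (indicator {0<..} w * ennreal (w ^ n) * h (G w)) * indicator {0..real N} w \<partial>lborel)" for N
  proof -
    have "(\<integral>\<^sup>+v. H v * indicator {G 0..G (real N)} v \<partial>lborel)
        = (\<integral>\<^sup>+w. H (G w) * ennreal (w / G w) * indicator {0..real N} w \<partial>lborel)"
    proof (cases "N = 0")
      case True
      have "(\<integral>\<^sup>+v. H v * indicator {G 0} v \<partial>lborel) = 0" "(\<integral>\<^sup>+w. H (G w) * ennreal (w / G w) * indicator {0} w \<partial>lborel) = 0"
        by (simp_all add: G0)
      with True show ?thesis by simp
    next
      case False
      then show ?thesis
      proof (intro nn_integral_substitution_aux)
        show "(G has_real_derivative w / G w) (at w)" if "w \<in> {0..real N}" for w
          unfolding G_def using apos[of w]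
          by (auto intro!: derivative_eq_intros simp: field_simps)
        have "continuous_on {0..real N} G" unfolding G_def by (intro continuous_intros)
        then show "continuous_on {0..real N} (\<lambda>w. w / G w)"
          using Gpos by (intro continuous_intros) (auto simp: less_imp_neq[symmetric])
      qed (use Gpos in \<open>auto simp: less_imp_le\<close>)
    qed
    also have "\<dots> = (\<integral>\<^sup>+w. (indicator {0<..} w * ennreal (w ^ n) * h (G w)) * indicator {0..real N} w \<partial>lborel)"
    proof (intro nn_integral_cong_AE AE_I[of _ _ "{0}"] subsetI, goal_cases)
      case (1 w)
      then have "w = 0 \<or> w > 0" by (auto simp: indicator_def split: if_splits)
      moreover have "H (G w) * ennreal (w / G w) = ennreal (w ^ n) * h (G w)" if "w > 0"
      proof -
        have "(G w)\<^sup>2 - a\<^sup>2 = w\<^sup>2" using apos[of w] by (simp add: G_def)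
        moreover have "(w\<^sup>2) powr ((real n - 1) / 2) = w powr (real n - 1)"
          using that by (simp add: powr_def ln_realpow)
        ultimately have "ennreal (G w * ((G w)\<^sup>2 - a\<^sup>2) powr ((real n - 1) / 2)) * ennreal (w / G w) = ennreal (w * w powr (real n - 1))"
          using that Gpos[of w] by (subst ennreal_mult'[symmetric]) (auto simp: less_imp_le mult_ac)
        also have "w * w powr (real n - 1) = w ^ n"
          using that by (simp add: powr_mult_base powr_realpow)
        finally show ?thesis unfolding H_def by (simp add: mult_ac)
      qed
      ultimately show ?case using 1 by (auto simp: indicator_def split: if_splits)
    qed auto
    finally show ?thesis by (simp add: G0)
  qed
  have mono: "G x \<le> G y" if "0 \<le> x" "x \<le> y" for x y
    using that by (simp add: G_def power_mono)
  have lim1: "(\<lambda>N. \<integral>\<^sup>+w. (indicator {0<..} w * ennreal (w ^ n) * h (G w)) * indicator {0..real N} w \<partial>lborel)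
      \<longlonglongrightarrow> (\<integral>\<^sup>+w. indicator {0<..} w * ennreal (w ^ n) * h (G w) \<partial>lborel)"
  proof (rule nn_integral_LIMSEQ)
    show "incseq (\<lambda>N w. (indicator {0<..} w * ennreal (w ^ n) * h (G w)) * indicator {0..real N} w)"
      by (intro incseq_SucI le_funI mult_left_mono) (auto simp: indicator_def)
    fix w :: real
    obtain K :: nat where "w \<le> real K" using real_arch_simple by blast
    then have "eventually (\<lambda>N. (indicator {0<..} w * ennreal (w ^ n) * h (G w)) * indicator {0..real N} w
        = indicator {0<..} w * ennreal (w ^ n) * h (G w)) sequentially"
      by (intro eventually_sequentiallyI[of K]) (auto simp: indicator_def)
    then show "(\<lambda>N. (indicator {0<..} w * ennreal (w ^ n) * h (G w)) * indicator {0..real N} w)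
        \<longlonglongrightarrow> indicator {0<..} w * ennreal (w ^ n) * h (G w)" by (rule tendsto_eventually)
  qed (simp add: G_def)
  have lim2: "(\<lambda>N. \<integral>\<^sup>+v. H v * indicator {\<bar>a\<bar>..G (real N)} v \<partial>lborel)
      \<longlonglongrightarrow> (\<integral>\<^sup>+v. H v * indicator {\<bar>a\<bar>..} v \<partial>lborel)"
  proof (rule nn_integral_LIMSEQ)
    have "G (real N) \<le> G (real (Suc N))" for N by (intro mono) auto
    then show "incseq (\<lambda>N v. H v * indicator {\<bar>a\<bar>..G (real N)} v)"
      by (intro incseq_SucI le_funI mult_left_mono) (auto simp: indicator_def intro: order_trans)
    fix v :: real
    obtain K :: nat where K: "v \<le> real K" using real_arch_simple by blast
    have "v \<le> G (real N)" if "K \<le> N" for N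
    proof -
      have "v \<le> real N" using K that by linarith
      also have "real N = sqrt ((real N)\<^sup>2)" by simp
      also have "\<dots> \<le> G (real N)" unfolding G_def by (intro real_sqrt_le_mono) simp
      finally show ?thesis .
    qed
    then have "eventually (\<lambda>N. H v * indicator {\<bar>a\<bar>..G (real N)} v = H v * indicator {\<bar>a\<bar>..} v) sequentially"
      by (intro eventually_sequentiallyI[of K]) (auto simp: indicator_def)
    then show "(\<lambda>N. H v * indicator {\<bar>a\<bar>..G (real N)} v) \<longlonglongrightarrow> H v * indicator {\<bar>a\<bar>..} v" by (rule tendsto_eventually)
  qed simp
  have "(\<integral>\<^sup>+w. indicator {0<..} w * ennreal (w ^ n) * h (G w) \<partial>lborel) = (\<integral>\<^sup>+v. H v * indicator {\<bar>a\<bar>..} v \<partial>lborel)"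
    using lim1 lim2 unfolding bounded by (rule LIMSEQ_unique)
  also have "\<dots> = (\<integral>\<^sup>+v. indicator {\<bar>a\<bar><..} v * H v \<partial>lborel)"
    by (intro nn_integral_cong_AE AE_I[of _ _ "{\<bar>a\<bar>}"]) (auto simp: indicator_def split: if_splits)
  finally show ?thesis by (simp add: G_def H_def mult.assoc)
qed

text \<open>
  Split off the coordinate along \<open>e\<close>; the other \<open>n + 1\<close> coordinates enter only through their Euclidean
  norm and are integrated radially.
\<close>

lemma nn_integral_axial_cartesian:
  fixes e :: "'a::euclidean_space" and g :: "real \<Rightarrow> real \<Rightarrow> ennreal"
  assumes e: "e \<in> Basis" and n: "DIM('a) = Suc (Suc n)"
    and [measurable]: "case_prod g \<in> borel_measurable (borel \<Otimes>\<^sub>M borel)"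
  shows "(\<integral>\<^sup>+y. g (norm y) (y \<bullet> e) \<partial>lborel) = ennreal (real (Suc n) * unit_ball_vol (real (Suc n))) *
     (\<integral>\<^sup>+a. \<integral>\<^sup>+w. indicator {0<..} w * ennreal (w ^ n) * g (sqrt (a\<^sup>2 + w\<^sup>2)) a \<partial>lborel \<partial>lborel)"
proof -
  interpret product_sigma_finite "\<lambda>_::'a. lborel :: real measure" by standard
  define I where "I = (Basis - {e} :: 'a set)"
  have I: "finite I" "e \<notin> I" "insert e I = Basis" "card I = Suc n"
    using e n by (auto simp: I_def)
  have norm_sum: "norm (\<Sum>b\<in>Basis. f b *\<^sub>R b :: 'a) = sqrt (\<Sum>i\<in>Basis. (f i)\<^sup>2)" for f
    using euclidean_dist_l2[of "\<Sum>b\<in>Basis. f b *\<^sub>R b :: 'a" 0] by (simp add: L2_set_def)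
  have "(\<integral>\<^sup>+y. g (norm y) (y \<bullet> e) \<partial>lborel)
      = (\<integral>\<^sup>+f. g (norm (\<Sum>b\<in>Basis. f b *\<^sub>R b :: 'a)) ((\<Sum>b\<in>Basis. f b *\<^sub>R b) \<bullet> e) \<partial>PiM Basis (\<lambda>_. lborel))"
    by (subst lborel_eq, subst nn_integral_distr) simp_all
  also have "\<dots> = (\<integral>\<^sup>+f. g (sqrt (\<Sum>i\<in>Basis. (f i)\<^sup>2)) (f e) \<partial>PiM Basis (\<lambda>_. lborel))"
    using e by (simp add: norm_sum)
  also have "\<dots> = (\<integral>\<^sup>+f. g (sqrt ((f e)\<^sup>2 + (\<Sum>i\<in>I. (f i)\<^sup>2))) (f e) \<partial>PiM (insert e I) (\<lambda>_. lborel))"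
    unfolding I(3)[symmetric] using I(1,2) by simp
  also have "\<dots> = (\<integral>\<^sup>+a. \<integral>\<^sup>+f. g (sqrt (((f(e := a)) e)\<^sup>2 + (\<Sum>i\<in>I. ((f(e := a)) i)\<^sup>2))) ((f(e := a)) e) \<partial>PiM I (\<lambda>_. lborel) \<partial>lborel)"
  proof (rule product_nn_integral_insert_rev[OF I(1,2)])
    have [measurable]: "(\<lambda>f. f i) \<in> borel_measurable (PiM (insert e I) (\<lambda>_. lborel :: real measure))" if "i \<in> insert e I" for i
      using measurable_component_singleton[OF that, of "\<lambda>_. lborel :: real measure"] by simp
    show "(\<lambda>f. g (sqrt ((f e)\<^sup>2 + (\<Sum>i\<in>I. (f i)\<^sup>2))) (f e)) \<in> borel_measurable (PiM (insert e I) (\<lambda>_. lborel))"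
      by measurable
  qed
  also have "\<dots> = (\<integral>\<^sup>+a. \<integral>\<^sup>+f. g (sqrt (a\<^sup>2 + (sqrt (\<Sum>i\<in>I. (f i)\<^sup>2))\<^sup>2)) a \<partial>PiM I (\<lambda>_. lborel) \<partial>lborel)"
  proof -
    have *: "(\<Sum>i\<in>I. ((f(e := a)) i)\<^sup>2) = (\<Sum>i\<in>I. (f i)\<^sup>2)" for f :: "'a \<Rightarrow> real" and a
      using I(2) by (intro sum.cong) auto
    show ?thesis unfolding * by (simp add: sum_nonneg)
  qed
  also have "\<dots> = (\<integral>\<^sup>+a. ennreal (real (Suc n) * unit_ball_vol (real (Suc n))) *
      (\<integral>\<^sup>+w. indicator {0<..} w * ennreal (w ^ n) * g (sqrt (a\<^sup>2 + w\<^sup>2)) a \<partial>lborel) \<partial>lborel)"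
  proof (rule nn_integral_cong, goal_cases)
    case (1 a)
    show ?case
    proof (subst nn_integral_radial[where N = "\<lambda>f. sqrt (\<Sum>i\<in>I. (f i)\<^sup>2)" and h = "\<lambda>w. g (sqrt (a\<^sup>2 + w\<^sup>2)) a" and n="Suc n" and V="unit_ball_vol (real (Suc n))"])
      show "emeasure (PiM I (\<lambda>_. lborel)) {f \<in> space (PiM I (\<lambda>_. lborel)). sqrt (\<Sum>i\<in>I. (f i)\<^sup>2) \<le> r}
          = ennreal (unit_ball_vol (real (Suc n)) * r ^ Suc n)" if "0 < r" for r
        using emeasure_cball_aux[OF I(1) that] unfolding I(4)
        by (auto intro!: arg_cong2[where f=emeasure] simp: Int_def conj_commute)
    qed (auto simp: sum_nonneg)
  qed
  finally show ?thesis by (simp add: nn_integral_cmult)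
qed

text \<open>
  Spherical coordinates \<open>v = |y|\<close> and \<open>1 - s = cos \<theta>\<close>, where \<open>\<theta>\<close> is the angle between \<open>y\<close> and the axis. The
  weight \<open>(s (2 - s))\<^bsup>(n - 1) / 2\<^esup> = sin\<^bsup>n - 1\<^esup> \<theta>\<close> comes from the surface measure \<open>sin\<^bsup>n\<^esup> \<theta> d\<theta>\<close> of the
  sphere of dimension \<open>n + 1\<close> and from \<open>ds = sin \<theta> d\<theta>\<close>; measuring \<open>s\<close> from the pole puts the maximum of \<open>e\<^bsup>z cos \<theta>\<^esup>\<close> at \<open>s = 0\<close>.
\<close>

lemma nn_integral_axial:
  fixes e :: "'a::euclidean_space" and g :: "real \<Rightarrow> real \<Rightarrow> ennreal"
  assumes e: "e \<in> Basis" and n: "DIM('a) = Suc (Suc n)"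
    and [measurable]: "case_prod g \<in> borel_measurable (borel \<Otimes>\<^sub>M borel)"
  shows "(\<integral>\<^sup>+y. g (norm y) (y \<bullet> e) \<partial>lborel) = ennreal (real (Suc n) * unit_ball_vol (real (Suc n))) *
     (\<integral>\<^sup>+v. indicator {0<..} v * ennreal (v ^ Suc n) *
        (\<integral>\<^sup>+s. indicator {0<..<2} s * ennreal ((s * (2 - s)) powr ((real n - 1) / 2)) * g v (v * (1 - s)) \<partial>lborel) \<partial>lborel)"
proof -
  have [measurable]: "(\<lambda>x. g (f x) (h x)) \<in> borel_measurable M"
    if "f \<in> borel_measurable M" "h \<in> borel_measurable M" for M :: "'z measure" and f h
    using that by measurable
  define \<alpha> where "\<alpha> = (real n - 1) / 2"
  have "(\<integral>\<^sup>+a. \<integral>\<^sup>+w. indicator {0<..} w * ennreal (w ^ n) * g (sqrt (a\<^sup>2 + w\<^sup>2)) a \<partial>lborel \<partial>lborel)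
     = (\<integral>\<^sup>+a. \<integral>\<^sup>+v. indicator {\<bar>a\<bar><..} v * ennreal (v * (v\<^sup>2 - a\<^sup>2) powr \<alpha>) * g v a \<partial>lborel \<partial>lborel)"
  proof (intro nn_integral_cong_AE)
    have "AE a in lborel. a \<noteq> (0::real)" by (rule AE_lborel_singleton)
    then show "AE a in lborel. (\<integral>\<^sup>+w. indicator {0<..} w * ennreal (w ^ n) * g (sqrt (a\<^sup>2 + w\<^sup>2)) a \<partial>lborel)
        = (\<integral>\<^sup>+v. indicator {\<bar>a\<bar><..} v * ennreal (v * (v\<^sup>2 - a\<^sup>2) powr \<alpha>) * g v a \<partial>lborel)"
      unfolding \<alpha>_def by eventually_elim (rule nn_integral_substitution_hypot, simp_all)
  qed
  also have "\<dots> = (\<integral>\<^sup>+v. \<integral>\<^sup>+a. indicator {\<bar>a\<bar><..} v * ennreal (v * (v\<^sup>2 - a\<^sup>2) powr \<alpha>) * g v a \<partial>lborel \<partial>lborel)"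
    unfolding indicator_def greaterThan_def mem_Collect_eq
    by (rule lborel_pair.Fubini'[symmetric]) measurable
  also have "\<dots> = (\<integral>\<^sup>+v. indicator {0<..} v * ennreal (v ^ Suc n) *
        (\<integral>\<^sup>+s. indicator {0<..<2} s * ennreal ((s * (2 - s)) powr \<alpha>) * g v (v * (1 - s)) \<partial>lborel) \<partial>lborel)"
  proof (rule nn_integral_cong)
    fix v :: real
    show "(\<integral>\<^sup>+a. indicator {\<bar>a\<bar><..} v * ennreal (v * (v\<^sup>2 - a\<^sup>2) powr \<alpha>) * g v a \<partial>lborel)
      = indicator {0<..} v * ennreal (v ^ Suc n) *
        (\<integral>\<^sup>+s. indicator {0<..<2} s * ennreal ((s * (2 - s)) powr \<alpha>) * g v (v * (1 - s)) \<partial>lborel)"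
    proof (cases "0 < v")
      case False
      then have "indicator {\<bar>a\<bar><..} v = (0::ennreal)" for a by (auto simp: indicator_def)
      with False show ?thesis by simp
    next
      case True
      have "(\<integral>\<^sup>+a. indicator {\<bar>a\<bar><..} v * ennreal (v * (v\<^sup>2 - a\<^sup>2) powr \<alpha>) * g v a \<partial>lborel)
         = ennreal v * (\<integral>\<^sup>+s. indicator {\<bar>v + (-v) * s\<bar><..} v * ennreal (v * (v\<^sup>2 - (v + (-v) * s)\<^sup>2) powr \<alpha>) * g v (v + (-v) * s) \<partial>lborel)"
        unfolding indicator_def greaterThan_def mem_Collect_eq
        using True by (subst nn_integral_real_affine[where c="-v" and t=v]) auto
      also have "\<dots> = ennreal v * (\<integral>\<^sup>+s. ennreal (v ^ n) * (indicator {0<..<2} s * ennreal ((s * (2 - s)) powr \<alpha>) * g v (v * (1 - s))) \<partial>lborel)"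
      proof (rule arg_cong[where f="(*) (ennreal v)"], rule nn_integral_cong, goal_cases)
        case (1 s)
        have "\<bar>v + (-v) * s\<bar> < v \<longleftrightarrow> 0 < s \<and> s < 2"
        proof -
          have "\<bar>v + (-v) * s\<bar> < v \<longleftrightarrow> 0 < v * s \<and> v * s < v * 2"
            unfolding abs_less_iff by (intro iffI conjI; linarith)
          also have "0 < v * s \<longleftrightarrow> 0 < s" using True by (simp add: zero_less_mult_iff)
          also have "v * s < v * 2 \<longleftrightarrow> s < 2" using True by (rule mult_less_cancel_left_pos)
          finally show ?thesis .
        qed
        moreover have "ennreal (v * (v\<^sup>2 - (v + (-v) * s)\<^sup>2) powr \<alpha>) = ennreal (v ^ n) * ennreal ((s * (2 - s)) powr \<alpha>)" if "0 < s" "s < 2"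
        proof -
          have "v\<^sup>2 - (v + (-v) * s)\<^sup>2 = v\<^sup>2 * (s * (2 - s))" by (simp add: power2_eq_square algebra_simps)
          moreover have "(v\<^sup>2 * (s * (2 - s))) powr \<alpha> = (v\<^sup>2) powr \<alpha> * (s * (2 - s)) powr \<alpha>"
            using that True by (intro powr_mult)
          moreover have "(v\<^sup>2) powr \<alpha> = v powr (real n - 1)"
            using True by (simp add: powr_def ln_realpow \<alpha>_def)
          moreover have "v * v powr (real n - 1) = v ^ n"
            using True by (simp add: powr_mult_base powr_realpow)
          ultimately have "v * (v\<^sup>2 - (v + (-v) * s)\<^sup>2) powr \<alpha> = v ^ n * (s * (2 - s)) powr \<alpha>"
            by (metis mult.assoc)
          then show ?thesis using True by (simp add: ennreal_mult')
        qed
        moreover have "v + (-v) * s = v * (1 - s)" by (simp add: algebra_simps)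
        ultimately show ?case by (simp only: indicator_def greaterThan_iff greaterThanLessThan_iff of_bool_def) (simp add: mult_ac)
      qed
      also have "\<dots> = ennreal v * (ennreal (v ^ n) * (\<integral>\<^sup>+s. (indicator {0<..<2} s * ennreal ((s * (2 - s)) powr \<alpha>) * g v (v * (1 - s))) \<partial>lborel))"
        by (subst nn_integral_cmult) auto
      finally show ?thesis using True by (simp add: ennreal_mult' mult.assoc)
    qed
  qed
  finally show ?thesis
    using nn_integral_axial_cartesian[OF e n, of g] by (simp add: \<alpha>_def)
qed

text \<open>
  The direction of \<open>x\<close> is irrelevant for integrands that see \<open>y\<close> only through \<open>|y|\<close> and \<open>y \<bullet> x\<close>: rotate it onto \<open>e\<close>.
\<close>

lemma nn_integral_norm_inner_cong:
  fixes e x :: "'a::euclidean_space" and g :: "real \<Rightarrow> real \<Rightarrow> ennreal"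
  assumes "norm e = norm x"
    and [measurable]: "case_prod g \<in> borel_measurable (borel \<Otimes>\<^sub>M borel)"
  shows "(\<integral>\<^sup>+y. g (norm y) (y \<bullet> x) \<partial>lborel) = (\<integral>\<^sup>+y. g (norm y) (y \<bullet> e) \<partial>lborel)"
proof -
  obtain f where f: "orthogonal_transformation f" "f e = x"
    using exists_orthogonal_transformation_mapping[OF assms(1)] .
  then have [measurable]: "f \<in> borel_measurable borel"
    by (intro borel_measurable_continuous_onI linear_continuous_on linear_conv_bounded_linear[THEN iffD1] orthogonal_transformation_linear)
  have "(\<integral>\<^sup>+y. g (norm y) (y \<bullet> x) \<partial>lborel) = (\<integral>\<^sup>+y. g (norm y) (y \<bullet> x) \<partial>distr lborel borel f)"
    by (simp add: lborel_distr_orthogonal_transformation f)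
  also have "\<dots> = (\<integral>\<^sup>+y. g (norm (f y)) (f y \<bullet> f e) \<partial>lborel)"
    by (subst nn_integral_distr) (auto simp: f)
  also have "\<dots> = (\<integral>\<^sup>+y. g (norm y) (y \<bullet> e) \<partial>lborel)"
    using f(1) by (simp add: orthogonal_transformation_norm) (simp add: orthogonal_transformation_def)
  finally show ?thesis .
qed

section \<open>Large arguments of the scaled Bessel integral\<close>

lemma ennreal_le_add_imp_diff_le:
  assumes "ennreal x \<le> J + ennreal y" "0 \<le> y"
  shows "ennreal (x - y) \<le> J"
proof (cases J)
  case (real j)
  then have "ennreal x \<le> ennreal (j + y)" using assms by simp
  then have "x - y \<le> j" using real assms by (subst (asm) ennreal_le_iff) auto
  then show ?thesis using real by (simp add: ennreal_leI)
qed simp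

lemma nn_integral_Gamma_scaled:
  fixes x z :: real
  assumes "0 < x" "0 < z"
  shows "(\<integral>\<^sup>+s. indicator {0<..} s * ennreal (s powr (x - 1) * exp (- (z * s))) \<partial>lborel) = ennreal (Gamma x * z powr (- x))"
proof -
  have "ennreal (Gamma x) = (\<integral>\<^sup>+t. ennreal (indicator {0..} t * t powr (x - 1) / exp t) \<partial>lborel)"
    by (rule Gamma_conv_nn_integral_real[OF assms(1)])
  also have "\<dots> = ennreal \<bar>z\<bar> * (\<integral>\<^sup>+s. ennreal (indicator {0..} (0 + z * s) * (0 + z * s) powr (x - 1) / exp (0 + z * s)) \<partial>lborel)"
    using assms by (intro nn_integral_real_affine) auto
  also have "(\<integral>\<^sup>+s. ennreal (indicator {0..} (0 + z * s) * (0 + z * s) powr (x - 1) / exp (0 + z * s)) \<partial>lborel)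
     = (\<integral>\<^sup>+s. ennreal (z powr (x - 1)) * (indicator {0<..} s * ennreal (s powr (x - 1) * exp (- (z * s)))) \<partial>lborel)"
  proof (intro nn_integral_cong_AE AE_I[of _ _ "{0}"] subsetI CollectI, rule ccontr, goal_cases)
    case (1 s)
    moreover have "s < 0 \<Longrightarrow> z * s < 0" using assms by (simp add: mult_pos_neg)
    ultimately show ?case using assms
      by (cases "s > 0") (auto simp: indicator_def powr_mult exp_minus field_simps ennreal_mult'[symmetric])
  qed auto
  finally have *: "ennreal (Gamma x) = ennreal z * (ennreal (z powr (x - 1)) * (\<integral>\<^sup>+s. indicator {0<..} s * ennreal (s powr (x - 1) * exp (- (z * s))) \<partial>lborel))"
    using assms by (simp add: nn_integral_cmult)
  define I where "I = (\<integral>\<^sup>+s. indicator {0<..} s * ennreal (s powr (x - 1) * exp (- (z * s))) \<partial>lborel)"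
  have "ennreal (Gamma x * z powr (- x)) = ennreal (z powr (-x)) * ennreal (Gamma x)"
    using assms by (simp add: ennreal_mult'[symmetric] mult.commute)
  also have "\<dots> = (ennreal (z powr (-x)) * ennreal z * ennreal (z powr (x - 1))) * I"
    unfolding * I_def by (simp add: mult.assoc)
  also have "ennreal (z powr (-x)) * ennreal z * ennreal (z powr (x - 1)) = ennreal (z powr (-x) * z * z powr (x - 1))"
    using assms by (simp add: ennreal_mult'[symmetric])
  also have "z powr (-x) * z * z powr (x - 1) = 1"
    using assms by (simp add: powr_diff powr_minus field_simps)
  finally show ?thesis by (simp add: I_def)
qed

text \<open>
  The maximum of \<open>z\<^sup>p e\<^sup>-\<^sup>z\<close> is attained at \<open>z = p\<close>; this is how an exponentially small remainder is absorbed into a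
  power of \<open>1/z\<close>.
\<close>

lemma powr_exp_minus_le:
  fixes z p :: real
  assumes "0 < z" "0 < p"
  shows "exp (- z) \<le> p powr p * z powr (- p)"
proof -
  have "ln (z / p) \<le> z / p - 1" using assms by (intro ln_le_minus_one) simp
  then have "p * (ln z - ln p) \<le> z - p" using assms by (simp add: ln_div field_simps)
  then have "exp (- z) \<le> exp (p * ln p - p * ln z)" using assms by (simp add: algebra_simps)
  also have "\<dots> = p powr p * z powr (- p)"
    using assms by (simp add: powr_def exp_diff exp_minus field_simps)
  finally show ?thesis .
qed

text \<open>
  Up to elementary factors, \<open>e\<^bsup>z\<^esup> scaled_bessel \<alpha> z\<close> is Poisson's integral for the modified Bessel function
  of order \<open>\<alpha> + 1/2\<close>, with the variable of integration measured from the end point at which the exponential peaks.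
\<close>

definition scaled_bessel :: "real \<Rightarrow> real \<Rightarrow> ennreal" where
  "scaled_bessel \<alpha> z = (\<integral>\<^sup>+s. indicator {0<..<2} s * ennreal ((s * (2 - s)) powr \<alpha> * exp (- (z * s))) \<partial>lborel)"

lemma one_minus_powr_ge:
  fixes t \<alpha> :: real
  assumes "0 \<le> t" "t < 1" "\<alpha> \<le> real N"
  shows "1 - real N * t \<le> (1 - t) powr \<alpha>"
proof -
  have "1 + real N * (- t) \<le> (1 + (- t)) ^ N"
    using assms by (intro Bernoulli_inequality) auto
  also have "\<dots> = (1 - t) powr real N"
    using assms by (simp add: powr_realpow)
  also have "\<dots> \<le> (1 - t) powr \<alpha>"
    using assms by (intro powr_mono') auto
  finally show ?thesis by simp
qed

text \<open>
  On \<open>t < 1/2\<close> the exponent \<open>-1/2\<close> is the worst one and the bound is linear in \<open>t\<close>. The last summand takes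
  care of the integrable singularity at \<open>t = 1\<close>, which occurs in dimension 2 only; it is harmless because
  the exponential is tiny there.
\<close>

lemma one_minus_powr_le:
  fixes t \<alpha> :: real
  assumes "0 \<le> t" "t < 1" "- (1/2) \<le> \<alpha>"
  shows "(1 - t) powr \<alpha> \<le> 1 + t + indicator {1/2..} t * (1 - t) powr (- (1/2))"
proof -
  have le: "(1 - t) powr \<alpha> \<le> (1 - t) powr (- (1/2))"
    using assms by (intro powr_mono') auto
  show ?thesis
  proof (cases "t < 1/2")
    case True
    have "1 \<le> (1 + t)\<^sup>2 * (1 - t)"
    proof -
      have "(1 + t)\<^sup>2 * (1 - t) - 1 = t * (1 - t - t * t)" by (simp add: power2_eq_square algebra_simps)
      moreover have "t * t \<le> 1/2 * (1/2)" using True assms by (intro mult_mono) auto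
      moreover have "0 \<le> t * (1 - t - t * t)"
        using calculation True assms by (intro mult_nonneg_nonneg) auto
      ultimately show ?thesis by linarith
    qed
    then have "sqrt 1 \<le> sqrt ((1 + t)\<^sup>2 * (1 - t))" by (rule real_sqrt_le_mono)
    then have "1 \<le> (1 + t) * sqrt (1 - t)" using assms by (simp add: real_sqrt_mult)
    moreover have "(1 - t) powr (- (1/2)) = 1 / sqrt (1 - t)"
      using assms by (simp add: powr_minus powr_half_sqrt field_simps)
    ultimately have "(1 - t) powr (- (1/2)) \<le> 1 + t" using assms by (simp add: pos_divide_le_eq)
    then show ?thesis using le True by (simp add: indicator_def)
  next
    case False
    then show ?thesis using le assms by (simp add: indicator_def)
  qed
qed

text \<open>
  With \<open>t = s / 2\<close> the integrand is \<open>2\<^bsup>m-1\<^esup> s\<^bsup>m-1\<^esup> (1 - t)\<^bsup>m-1\<^esup> e\<^bsup>-zs\<^esup>\<close>, and \<open>(1 - t)\<^bsup>m-1\<^esup>\<close> is at least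
  \<open>1 - N t\<close>. As this minorant is negative for \<open>t > 1\<close>, it may be integrated over the whole half-line, where
  the integrals are Gamma functions. Subtraction is avoided by moving the negative part to the other side.
\<close>

lemma scaled_bessel_lower:
  fixes m z :: real
  assumes "1/2 \<le> m" "0 < z" and N: "1 \<le> N" "m - 1 \<le> real N"
  shows "ennreal (2 powr (m - 1) * Gamma m * z powr (- m) * (1 - real N * m / 2 / z)) \<le> scaled_bessel (m - 1) z"
proof -
  define M where "M = real N"
  have "0 < m" "0 < M" "0 < Gamma m" using assms by (auto simp: M_def intro!: Gamma_real_pos)
  have "ennreal (2 powr (m - 1)) * ennreal (Gamma m * z powr (- m))
     = (\<integral>\<^sup>+s. ennreal (2 powr (m - 1)) * (indicator {0<..} s * ennreal (s powr (m - 1) * exp (- (z * s)))) \<partial>lborel)"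
    using assms by (simp add: nn_integral_cmult nn_integral_Gamma_scaled)
  also have "\<dots> \<le> (\<integral>\<^sup>+s. indicator {0<..<2} s * ennreal ((s * (2 - s)) powr (m - 1) * exp (- (z * s)))
       + ennreal (2 powr (m - 1) * M / 2) * (indicator {0<..} s * ennreal (s powr (m + 1 - 1) * exp (- (z * s)))) \<partial>lborel)"
  proof (rule nn_integral_mono)
    fix s :: real
    show "ennreal (2 powr (m - 1)) * (indicator {0<..} s * ennreal (s powr (m - 1) * exp (- (z * s))))
       \<le> indicator {0<..<2} s * ennreal ((s * (2 - s)) powr (m - 1) * exp (- (z * s)))
       + ennreal (2 powr (m - 1) * M / 2) * (indicator {0<..} s * ennreal (s powr (m + 1 - 1) * exp (- (z * s))))"
    proof (cases "0 < s")
      case True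
      define W where "W = (if s < 2 then (1 - s / 2) powr (m - 1) else 0)"
      have W0: "0 \<le> W" by (simp add: W_def)
      have W: "1 \<le> W + M * (s / 2)"
      proof (cases "s < 2")
        case True
        then show ?thesis using one_minus_powr_ge[of "s / 2" "m - 1" N] \<open>0 < s\<close> N by (simp add: W_def M_def)
      next
        case False
        have "1 * 1 \<le> M * (s / 2)" using False N by (intro mult_mono) (auto simp: M_def)
        then show ?thesis using False by (simp add: W_def)
      qed
      have *: "indicator {0<..<2} s * ennreal ((s * (2 - s)) powr (m - 1) * exp (- (z * s)))
          = ennreal (2 powr (m - 1) * s powr (m - 1) * exp (- (z * s)) * W)"
      proof (cases "s < 2")
        case True
        have "(s * (2 - s)) powr (m - 1) = (2 * s * (1 - s / 2)) powr (m - 1)" by (simp add: algebra_simps)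
        also have "\<dots> = 2 powr (m - 1) * s powr (m - 1) * (1 - s / 2) powr (m - 1)"
          using \<open>0 < s\<close> True by (simp add: powr_mult)
        finally show ?thesis using True \<open>0 < s\<close> by (simp add: W_def mult_ac)
      qed (simp add: W_def)
      have "2 powr (m - 1) * s powr (m - 1) * exp (- (z * s)) * 1
          \<le> 2 powr (m - 1) * s powr (m - 1) * exp (- (z * s)) * (W + M * (s / 2))"
        using W by (intro mult_left_mono) auto
      also have "\<dots> = 2 powr (m - 1) * s powr (m - 1) * exp (- (z * s)) * W
            + 2 powr (m - 1) * M / 2 * (s powr (m + 1 - 1) * exp (- (z * s)))"
        using True by (simp add: powr_diff field_simps)
      finally have "ennreal (2 powr (m - 1) * s powr (m - 1) * exp (- (z * s)))
         \<le> ennreal (2 powr (m - 1) * s powr (m - 1) * exp (- (z * s)) * W) + ennreal (2 powr (m - 1) * M / 2) * ennreal (s powr (m + 1 - 1) * exp (- (z * s)))"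
        using W0 \<open>0 < M\<close> by (simp add: ennreal_plus[symmetric] ennreal_mult'[symmetric] ennreal_leI del: ennreal_plus)
      then show ?thesis unfolding * using True by (simp add: ennreal_mult' mult.assoc)
    qed simp
  qed
  also have "\<dots> = scaled_bessel (m - 1) z + ennreal (2 powr (m - 1) * M / 2) * ennreal (Gamma (m + 1) * z powr (- (m + 1)))"
    unfolding scaled_bessel_def using assms
    by (subst nn_integral_add) (auto simp: nn_integral_cmult nn_integral_Gamma_scaled[of "m + 1" z, simplified])
  finally have "ennreal (2 powr (m - 1) * (Gamma m * z powr (- m)))
      \<le> scaled_bessel (m - 1) z + ennreal (2 powr (m - 1) * M / 2 * (Gamma (m + 1) * z powr (- (m + 1))))"
    using \<open>0 < M\<close> by (subst (1 2) ennreal_mult') auto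
  then have "ennreal (2 powr (m - 1) * (Gamma m * z powr (- m)) - 2 powr (m - 1) * M / 2 * (Gamma (m + 1) * z powr (- (m + 1)))) \<le> scaled_bessel (m - 1) z"
    using assms \<open>0 < M\<close> by (intro ennreal_le_add_imp_diff_le) (auto intro!: mult_nonneg_nonneg Gamma_real_nonneg)
  also have "2 powr (m - 1) * (Gamma m * z powr (- m)) - 2 powr (m - 1) * M / 2 * (Gamma (m + 1) * z powr (- (m + 1)))
     = 2 powr (m - 1) * Gamma m * z powr (- m) * (1 - M * m / 2 / z)"
  proof -
    have "Gamma (m + 1) = m * Gamma m" using assms by (intro Gamma_plus1) (auto elim!: nonpos_Ints_cases)
    moreover have "z powr (- (m + 1)) = z powr (- m) / z" using assms by (simp add: powr_diff)
    ultimately show ?thesis by (simp add: field_simps)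
  qed
  finally show ?thesis by (simp add: M_def)
qed

text \<open>
  The three summands of the bound for \<open>(1 - s/2)\<^bsup>m-1\<^esup>\<close> give the leading term, a term smaller by a factor
  \<open>1/z\<close>, and a remainder over \<open>1 \<le> s < 2\<close> that is \<open>O(e\<^sup>-\<^sup>z)\<close>.
\<close>

lemma scaled_bessel_upper:
  fixes m :: real
  assumes "1/2 \<le> m"
  shows "\<exists>K\<ge>0. \<forall>z\<ge>1. scaled_bessel (m - 1) z \<le> ennreal (2 powr (m - 1) * Gamma m * z powr (- m) * (1 + K / z))"
proof -
  \<comment> \<open>the constant C bounds the integral of all factors but the exponential over [1, 2]\<close>
  define C where "C = 2 powr (m - 1) * 2 powr \<bar>m - 1\<bar> * (sqrt 2 * exp 1 * Gamma (1/2))"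
  define K where "K = m / 2 + C * (m + 1) powr (m + 1) / (2 powr (m - 1) * Gamma m)"
  have "0 < m" "0 < Gamma m" "0 \<le> C" using assms by (auto simp: C_def intro!: mult_nonneg_nonneg)
  have "scaled_bessel (m - 1) z \<le> ennreal (2 powr (m - 1) * Gamma m * z powr (- m) * (1 + K / z))" if z: "1 \<le> z" for z
  proof -
    have "scaled_bessel (m - 1) z \<le> (\<integral>\<^sup>+s. (ennreal (2 powr (m - 1)) * (indicator {0<..} s * ennreal (s powr (m - 1) * exp (- (z * s))))
       + ennreal (2 powr (m - 1) / 2) * (indicator {0<..} s * ennreal (s powr (m + 1 - 1) * exp (- (z * s)))))
       + ennreal (2 powr (m - 1) * 2 powr \<bar>m - 1\<bar> * exp (- z) * sqrt 2 * exp 1) * (indicator {0<..} (2 - s) * ennreal ((2 - s) powr (1/2 - 1) * exp (- (1 * (2 - s))))) \<partial>lborel)"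
      unfolding scaled_bessel_def
    proof (rule nn_integral_mono)
      fix s :: real
      show "indicator {0<..<2} s * ennreal ((s * (2 - s)) powr (m - 1) * exp (- (z * s))) \<le> (ennreal (2 powr (m - 1)) * (indicator {0<..} s * ennreal (s powr (m - 1) * exp (- (z * s))))
       + ennreal (2 powr (m - 1) / 2) * (indicator {0<..} s * ennreal (s powr (m + 1 - 1) * exp (- (z * s)))))
       + ennreal (2 powr (m - 1) * 2 powr \<bar>m - 1\<bar> * exp (- z) * sqrt 2 * exp 1) * (indicator {0<..} (2 - s) * ennreal ((2 - s) powr (1/2 - 1) * exp (- (1 * (2 - s)))))"
      proof (cases "0 < s \<and> s < 2")
        case True
        define E where "E = s powr (m - 1) * exp (- (z * s))"
        have "(s * (2 - s)) powr (m - 1) = (2 * s * (1 - s / 2)) powr (m - 1)" by (simp add: algebra_simps)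
        also have "\<dots> = 2 powr (m - 1) * s powr (m - 1) * (1 - s / 2) powr (m - 1)"
          using True by (simp add: powr_mult)
        finally have "(s * (2 - s)) powr (m - 1) * exp (- (z * s)) = 2 powr (m - 1) * E * (1 - s / 2) powr (m - 1)"
          by (simp add: E_def)
        also have "\<dots> \<le> 2 powr (m - 1) * E * (1 + s / 2 + indicator {1/2..} (s / 2) * (1 - s / 2) powr (- (1/2)))"
          using True assms by (intro mult_left_mono one_minus_powr_le) (auto simp: E_def)
        also have "\<dots> = 2 powr (m - 1) * E + 2 powr (m - 1) / 2 * (E * s) + 2 powr (m - 1) * (E * (indicator {1/2..} (s / 2) * (1 - s / 2) powr (- (1/2))))"
          by (simp add: field_simps)
        also have "E * s = s powr (m + 1 - 1) * exp (- (z * s))"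
          using True by (simp add: E_def powr_diff)
        also have "E * (indicator {1/2..} (s / 2) * (1 - s / 2) powr (- (1/2))) \<le> (2 powr \<bar>m - 1\<bar> * exp (- z)) * (sqrt 2 * exp 1 * ((2 - s) powr (1/2 - 1) * exp (- (1 * (2 - s)))))"
        proof (cases "1 \<le> s")
          case False
          then have "indicator {1/2..} (s / 2) = (0::real)" by simp
          then show ?thesis by simp
        next
          case 1: True
          have "E \<le> 2 powr \<bar>m - 1\<bar> * exp (- z)" unfolding E_def
          proof (intro mult_mono)
            have "s powr (m - 1) \<le> s powr \<bar>m - 1\<bar>" using 1 by (intro powr_mono) auto
            also have "\<dots> \<le> 2 powr \<bar>m - 1\<bar>" using 1 True by (intro powr_mono2) auto
            finally show "s powr (m - 1) \<le> 2 powr \<bar>m - 1\<bar>" .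
            have "z * 1 \<le> z * s" using z 1 by (intro mult_left_mono) auto
            then show "exp (- (z * s)) \<le> exp (- z)" by simp
          qed auto
          moreover have "(1 - s / 2) powr (- (1/2)) \<le> sqrt 2 * exp 1 * ((2 - s) powr (1/2 - 1) * exp (- (1 * (2 - s))))"
          proof -
            have "(1 - s / 2) powr (- (1/2)) = ((2 - s) / 2) powr (- (1/2))" by (simp add: diff_divide_distrib)
            also have "\<dots> = sqrt 2 * (2 - s) powr (1/2 - 1) * 1"
              using True by (simp add: powr_divide powr_minus powr_half_sqrt field_simps)
            also have "\<dots> \<le> sqrt 2 * (2 - s) powr (1/2 - 1) * (exp 1 * exp (- (1 * (2 - s))))"
              using 1 by (intro mult_left_mono) (auto simp: exp_add[symmetric])
            finally show ?thesis by (simp add: mult_ac)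
          qed
          ultimately have "E * (1 - s / 2) powr (- (1/2)) \<le> (2 powr \<bar>m - 1\<bar> * exp (- z)) * (sqrt 2 * exp 1 * ((2 - s) powr (1/2 - 1) * exp (- (1 * (2 - s)))))"
            by (intro mult_mono) auto
          then show ?thesis using 1 by simp
        qed
        finally have "(s * (2 - s)) powr (m - 1) * exp (- (z * s)) \<le> 2 powr (m - 1) * E + 2 powr (m - 1) / 2 * (s powr (m + 1 - 1) * exp (- (z * s)))
           + (2 powr (m - 1) * 2 powr \<bar>m - 1\<bar> * exp (- z) * sqrt 2 * exp 1) * ((2 - s) powr (1/2 - 1) * exp (- (1 * (2 - s))))"
          by (simp add: mult_ac)
        then have "ennreal ((s * (2 - s)) powr (m - 1) * exp (- (z * s))) \<le> ennreal (2 powr (m - 1) * E) + ennreal (2 powr (m - 1) / 2 * (s powr (m + 1 - 1) * exp (- (z * s))))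
           + ennreal ((2 powr (m - 1) * 2 powr \<bar>m - 1\<bar> * exp (- z) * sqrt 2 * exp 1) * ((2 - s) powr (1/2 - 1) * exp (- (1 * (2 - s)))))"
          by (subst ennreal_plus[symmetric], simp add: E_def, simp)+ (rule ennreal_leI)
        also have "ennreal (2 powr (m - 1) * E) = ennreal (2 powr (m - 1)) * ennreal E"
          by (rule ennreal_mult') simp
        also have "ennreal (2 powr (m - 1) / 2 * (s powr (m + 1 - 1) * exp (- (z * s)))) = ennreal (2 powr (m - 1) / 2) * ennreal (s powr (m + 1 - 1) * exp (- (z * s)))"
          by (rule ennreal_mult') simp
        also have "ennreal ((2 powr (m - 1) * 2 powr \<bar>m - 1\<bar> * exp (- z) * sqrt 2 * exp 1) * ((2 - s) powr (1/2 - 1) * exp (- (1 * (2 - s)))))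
          = ennreal (2 powr (m - 1) * 2 powr \<bar>m - 1\<bar> * exp (- z) * sqrt 2 * exp 1) * ennreal ((2 - s) powr (1/2 - 1) * exp (- (1 * (2 - s))))"
          by (rule ennreal_mult') simp
        finally show ?thesis using True by (simp only: E_def indicator_simps greaterThan_iff greaterThanLessThan_iff mult_1_left diff_gt_0_iff_gt)
      qed auto
    qed
    also have "\<dots> = ennreal (2 powr (m - 1)) * ennreal (Gamma m * z powr (- m)) + ennreal (2 powr (m - 1) / 2) * ennreal (Gamma (m + 1) * z powr (- (m + 1)))
       + ennreal (2 powr (m - 1) * 2 powr \<bar>m - 1\<bar> * exp (- z) * sqrt 2 * exp 1) * ennreal (Gamma (1/2))"
    proof -
      have "(\<integral>\<^sup>+s. indicator {0<..} s * ennreal (s powr (1/2 - 1) * exp (- (1 * s))) \<partial>lborel) = ennreal (Gamma (1/2) * 1 powr (- (1/2)))"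
        by (rule nn_integral_Gamma_scaled) auto
      then have "(\<integral>\<^sup>+s. indicator {0<..} (2 - s) * ennreal ((2 - s) powr (1/2 - 1) * exp (- (1 * (2 - s)))) \<partial>lborel) = ennreal (Gamma (1/2))"
        by (subst (asm) nn_integral_real_affine[where c="-1" and t=2]) (auto simp: indicator_def)
      moreover have "(\<integral>\<^sup>+s. indicator {0<..} s * ennreal (s powr (m + 1 - 1) * exp (- (z * s))) \<partial>lborel) = ennreal (Gamma (m + 1) * z powr (- (m + 1)))"
        using assms z by (intro nn_integral_Gamma_scaled) auto
      moreover have "(\<integral>\<^sup>+s. indicator {0<..} s * ennreal (s powr (m - 1) * exp (- (z * s))) \<partial>lborel) = ennreal (Gamma m * z powr (- m))"
        using assms z by (intro nn_integral_Gamma_scaled) auto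
      ultimately show ?thesis
        by (subst nn_integral_add, simp, simp, subst nn_integral_add, simp, simp, (subst nn_integral_cmult, simp)+) (simp only:)
    qed
    also have "\<dots> = ennreal (2 powr (m - 1) * (Gamma m * z powr (- m)) + 2 powr (m - 1) / 2 * (Gamma (m + 1) * z powr (- (m + 1))) + C * exp (- z))"
      using assms \<open>0 \<le> C\<close> by (simp add: ennreal_mult'[symmetric] ennreal_plus[symmetric] Gamma_real_nonneg C_def mult_ac del: ennreal_plus)
    also have "\<dots> \<le> ennreal (2 powr (m - 1) * Gamma m * z powr (- m) * (1 + K / z))"
    proof (rule ennreal_leI)
      have G: "Gamma (m + 1) = m * Gamma m" using assms by (intro Gamma_plus1) (auto elim!: nonpos_Ints_cases)
      have zp: "z powr (- (m + 1)) = z powr (- m) / z" using z by (simp add: powr_diff)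
      have "C * exp (- z) \<le> C * ((m + 1) powr (m + 1) * z powr (- (m + 1)))"
        using z assms \<open>0 \<le> C\<close> by (intro mult_left_mono powr_exp_minus_le) auto
      moreover have "2 powr (m - 1) * Gamma m * z powr (- m) * (1 + K / z) = 2 powr (m - 1) * (Gamma m * z powr (- m))
          + 2 powr (m - 1) / 2 * (m * Gamma m * (z powr (- m) / z)) + C * ((m + 1) powr (m + 1) * (z powr (- m) / z))"
        using z \<open>0 < Gamma m\<close> unfolding K_def by (simp add: field_simps)
      ultimately show "2 powr (m - 1) * (Gamma m * z powr (- m)) + 2 powr (m - 1) / 2 * (Gamma (m + 1) * z powr (- (m + 1))) + C * exp (- z)
         \<le> 2 powr (m - 1) * Gamma m * z powr (- m) * (1 + K / z)"
        unfolding G zp by linarith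
    qed
    finally show ?thesis .
  qed
  moreover have "0 \<le> K" using \<open>0 < m\<close> \<open>0 < Gamma m\<close> \<open>0 \<le> C\<close> by (simp add: K_def)
  ultimately show ?thesis by blast
qed

section \<open>Laplace's method at the corner of a quadrant\<close>

lemma nn_integral_power_exp_scaled:
  fixes t :: real
  assumes t: "0 < t"
  shows "(\<integral>\<^sup>+p. indicator {0..} p * ennreal (p ^ k * exp (- (t * p))) \<partial>lborel) = ennreal (fact k / t ^ Suc k)"
proof -
  have "(\<integral>\<^sup>+p. indicator {0..} p * ennreal (p ^ k * exp (- (t * p))) \<partial>lborel)
      = (\<integral>\<^sup>+p. indicator {0<..} p * ennreal (p powr (real (Suc k) - 1) * exp (- (t * p))) \<partial>lborel)"
    by (intro nn_integral_cong_AE AE_I[of _ _ "{0}"])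
       (auto simp: indicator_def powr_realpow split: if_splits)
  also have "\<dots> = ennreal (Gamma (real (Suc k)) * t powr (- real (Suc k)))"
    using t by (intro nn_integral_Gamma_scaled) auto
  also have "Gamma (real (Suc k)) = fact k"
    using Gamma_fact[of k, where ?'a = real] by (simp add: add.commute)
  also have "t powr (- real (Suc k)) = 1 / t ^ Suc k"
    using t by (simp only: powr_minus powr_realpow inverse_eq_divide)
  finally show ?thesis by simp
qed

lemma nn_integral_two_exp:
  assumes "0 < s" "0 < t"
  shows "(\<integral>\<^sup>+x. \<integral>\<^sup>+y. (indicator {0..} x * indicator {0..} y) * ennreal ((x ^ k * exp (- (s * x))) * (y ^ l * exp (- (t * y)))) \<partial>lborel \<partial>lborel)
     = ennreal (fact k / s ^ Suc k * (fact l / t ^ Suc l))"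
proof -
  have "(\<integral>\<^sup>+x. \<integral>\<^sup>+y. (indicator {0..} x * indicator {0..} y) * ennreal ((x ^ k * exp (- (s * x))) * (y ^ l * exp (- (t * y)))) \<partial>lborel \<partial>lborel)
    = (\<integral>\<^sup>+x. \<integral>\<^sup>+y. (indicator {0..} x * ennreal (x ^ k * exp (- (s * x)))) * (indicator {0..} y * ennreal (y ^ l * exp (- (t * y)))) \<partial>lborel \<partial>lborel)"
  proof (intro nn_integral_cong)
    fix x y :: real
    show "(indicator {0..} x * indicator {0..} y) * ennreal ((x ^ k * exp (- (s * x))) * (y ^ l * exp (- (t * y))))
      = (indicator {0..} x * ennreal (x ^ k * exp (- (s * x)))) * (indicator {0..} y * ennreal (y ^ l * exp (- (t * y))))"
    proof (cases "0 \<le> x")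
      case True
      then have "ennreal ((x ^ k * exp (- (s * x))) * (y ^ l * exp (- (t * y)))) = ennreal (x ^ k * exp (- (s * x))) * ennreal (y ^ l * exp (- (t * y)))"
        by (intro ennreal_mult') auto
      then show ?thesis by (simp only: mult_ac)
    qed simp
  qed
  also have "\<dots> = (\<integral>\<^sup>+x. (indicator {0..} x * ennreal (x ^ k * exp (- (s * x)))) * ennreal (fact l / t ^ Suc l) \<partial>lborel)"
    unfolding nn_integral_power_exp_scaled[OF assms(2), symmetric] by (intro nn_integral_cong nn_integral_cmult) measurable
  also have "\<dots> = ennreal (fact k / s ^ Suc k) * ennreal (fact l / t ^ Suc l)"
    unfolding nn_integral_power_exp_scaled[OF assms(1), symmetric] by (intro nn_integral_multc) measurable
  finally show ?thesis using assms by (simp add: ennreal_mult'[symmetric])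
qed

text \<open>
  The exponent is minus the quadratic form \<open>(a u\<^sup>2 + b v\<^sup>2) / 2 - \<kappa> u v\<close>, and the corner of the quadrant of integration is
  \<open>(R, \<mu> R)\<close>. The assumption \<open>slopes\<close> says that the form increases strictly in \<open>u\<close> and in \<open>v\<close> at the
  corner, at the rates \<open>A R\<close> and \<open>B R\<close> below.
\<close>

locale quadratic_corner =
  fixes a b \<kappa> \<mu> m :: real
  assumes pos: "0 < a" "0 < b" "0 < \<kappa>" "0 < \<mu>" "0 \<le> m"
    and psd: "\<kappa>\<^sup>2 \<le> a * b"
    and slopes: "0 < a - \<kappa> * \<mu>" "0 < b * \<mu> - \<kappa>"
begin

definition corner_integral :: "real \<Rightarrow> ennreal" where
  "corner_integral R = (\<integral>\<^sup>+u. \<integral>\<^sup>+v. indicator {R..} u * indicator {\<mu> * R..} v *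
      ennreal ((u * v) powr m * exp (- ((a * u\<^sup>2 + b * v\<^sup>2) / 2 - \<kappa> * (u * v)))) \<partial>lborel \<partial>lborel)"

definition A where "A = a - \<kappa> * \<mu>"
definition B where "B = b * \<mu> - \<kappa>"
definition peak where "peak R = (\<mu> * R\<^sup>2) powr m * exp (- (R\<^sup>2 * (a + b * \<mu>\<^sup>2 - 2 * \<kappa> * \<mu>) / 2))"
definition corner_term where "corner_term R = peak R / (A * B * R\<^sup>2)"

lemma AB: "0 < A" "0 < B" using slopes by (auto simp: A_def B_def)

definition excess where "excess x y = (a * x\<^sup>2 + b * y\<^sup>2) / 2 - \<kappa> * (x * y)"

lemma excess_nonneg: "0 \<le> excess x y"
proof -
  have "a * (2 * excess x y) = (a * x - \<kappa> * y)\<^sup>2 + (a * b - \<kappa>\<^sup>2) * y\<^sup>2"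
    by (simp add: excess_def power2_eq_square algebra_simps)
  then have "0 \<le> a * (2 * excess x y)" using psd by (auto intro!: add_nonneg_nonneg)
  then show ?thesis using pos by (simp add: zero_le_mult_iff)
qed

lemma excess_le: "0 \<le> x \<Longrightarrow> 0 \<le> y \<Longrightarrow> excess x y \<le> (a * x\<^sup>2 + b * y\<^sup>2) / 2"
proof -
  assume "0 \<le> x" "0 \<le> y"
  then have "0 \<le> \<kappa> * (x * y)" using pos by (intro mult_nonneg_nonneg) auto
  then show ?thesis unfolding excess_def by linarith
qed

lemma exponent_shift:
  "(a * (R + x)\<^sup>2 + b * (\<mu> * R + y)\<^sup>2) / 2 - \<kappa> * ((R + x) * (\<mu> * R + y))
    = R\<^sup>2 * (a + b * \<mu>\<^sup>2 - 2 * \<kappa> * \<mu>) / 2 + (A * R) * x + (B * R) * y + excess x y"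
  by (simp add: A_def B_def excess_def power2_eq_square field_simps)

definition weight where "weight R x y = (1 + x / R) powr m * (1 + y / (\<mu> * R)) powr m * exp (- excess x y)"

text \<open>
  Seen from the corner, the integrand is its value there times the exponential of a linear function times the factor
  \<open>weight\<close>, which tends to 1 on the relevant scale \<open>x, y = O(1/R)\<close>.
\<close>

lemma integrand_shift:
  assumes "0 < R" "0 \<le> x" "0 \<le> y"
  shows "((R + x) * (\<mu> * R + y)) powr m * exp (- ((a * (R + x)\<^sup>2 + b * (\<mu> * R + y)\<^sup>2) / 2 - \<kappa> * ((R + x) * (\<mu> * R + y))))
     = peak R * (exp (- (A * R * x)) * exp (- (B * R * y)) * weight R x y)"
proof -
  have "(R + x) * (\<mu> * R + y) = (\<mu> * R\<^sup>2) * (1 + x / R) * (1 + y / (\<mu> * R))"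
    using assms pos by (simp add: power2_eq_square field_simps)
  also have "\<dots> powr m = (\<mu> * R\<^sup>2) powr m * (1 + x / R) powr m * (1 + y / (\<mu> * R)) powr m"
    using assms pos by (simp add: powr_mult)
  finally show ?thesis
    unfolding exponent_shift by (simp add: peak_def weight_def exp_add[symmetric] algebra_simps)
qed

lemma corner_integral_eq:
  assumes R: "0 < R"
  shows "corner_integral R = ennreal (peak R) * (\<integral>\<^sup>+x. \<integral>\<^sup>+y. (indicator {0..} x * indicator {0..} y) *
       ennreal (exp (- (A * R * x)) * exp (- (B * R * y)) * weight R x y) \<partial>lborel \<partial>lborel)"
proof -
  have "corner_integral R = (\<integral>\<^sup>+x. \<integral>\<^sup>+v. indicator {R..} (R + 1 * x) * indicator {\<mu> * R..} v *
      ennreal (((R + 1 * x) * v) powr m * exp (- ((a * (R + 1 * x)\<^sup>2 + b * v\<^sup>2) / 2 - \<kappa> * ((R + 1 * x) * v)))) \<partial>lborel \<partial>lborel)"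
    unfolding corner_integral_def by (subst nn_integral_real_affine[where c=1 and t=R]) auto
  also have "\<dots> = (\<integral>\<^sup>+x. \<integral>\<^sup>+y. indicator {R..} (R + 1 * x) * indicator {\<mu> * R..} (\<mu> * R + 1 * y) *
      ennreal (((R + 1 * x) * (\<mu> * R + 1 * y)) powr m * exp (- ((a * (R + 1 * x)\<^sup>2 + b * (\<mu> * R + 1 * y)\<^sup>2) / 2 - \<kappa> * ((R + 1 * x) * (\<mu> * R + 1 * y))))) \<partial>lborel \<partial>lborel)"
    by (rule nn_integral_cong, subst nn_integral_real_affine[where c=1 and t="\<mu> * R"]) auto
  also have "\<dots> = (\<integral>\<^sup>+x. \<integral>\<^sup>+y. ennreal (peak R) * ((indicator {0..} x * indicator {0..} y) *
       ennreal (exp (- (A * R * x)) * exp (- (B * R * y)) * weight R x y)) \<partial>lborel \<partial>lborel)"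
  proof (intro nn_integral_cong)
    fix x y :: real
    have "0 \<le> peak R" by (simp add: peak_def)
    then show "indicator {R..} (R + 1 * x) * indicator {\<mu> * R..} (\<mu> * R + 1 * y) *
      ennreal (((R + 1 * x) * (\<mu> * R + 1 * y)) powr m * exp (- ((a * (R + 1 * x)\<^sup>2 + b * (\<mu> * R + 1 * y)\<^sup>2) / 2 - \<kappa> * ((R + 1 * x) * (\<mu> * R + 1 * y)))))
      = ennreal (peak R) * ((indicator {0..} x * indicator {0..} y) *
       ennreal (exp (- (A * R * x)) * exp (- (B * R * y)) * weight R x y))"
      using integrand_shift[OF R, of x y] by (auto simp: indicator_def ennreal_mult'[symmetric])
  qed
  finally show ?thesis by (simp add: nn_integral_cmult weight_def excess_def)
qed

text \<open>
  The powers in \<open>weight\<close> are at least 1, and its exponential factor is at least \<open>1 - excess\<close>. The excess is bounded by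
  squares because the mixed term \<open>- \<kappa> x y\<close> has the favourable sign, and the second moments of the
  exponential distributions are of relative size \<open>1/R\<^sup>2\<close>.
\<close>

lemma corner_integral_lower:
  assumes R: "0 < R"
  shows "ennreal (corner_term R * (1 - (a / A\<^sup>2 + b / B\<^sup>2) / R\<^sup>2)) \<le> corner_integral R"
proof -
  define X where "X = (\<integral>\<^sup>+x. \<integral>\<^sup>+y. (indicator {0..} x * indicator {0..} y) *
       ennreal (exp (- (A * R * x)) * exp (- (B * R * y)) * weight R x y) \<partial>lborel \<partial>lborel)"
  have AR: "0 < A * R" "0 < B * R" using R AB by auto
  have "ennreal (1 / (A * R) * (1 / (B * R)))
      = (\<integral>\<^sup>+x. \<integral>\<^sup>+y. (indicator {0..} x * indicator {0..} y) * ennreal ((x ^ 0 * exp (- ((A * R) * x))) * (y ^ 0 * exp (- ((B * R) * y)))) \<partial>lborel \<partial>lborel)"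
    using nn_integral_two_exp[OF AR, of 0 0] by simp
  also have "\<dots> \<le> (\<integral>\<^sup>+x. \<integral>\<^sup>+y. ((indicator {0..} x * indicator {0..} y) * ennreal (exp (- (A * R * x)) * exp (- (B * R * y)) * weight R x y)
       + ennreal (a / 2) * ((indicator {0..} x * indicator {0..} y) * ennreal ((x ^ 2 * exp (- ((A * R) * x))) * (y ^ 0 * exp (- ((B * R) * y))))))
       + ennreal (b / 2) * ((indicator {0..} x * indicator {0..} y) * ennreal ((x ^ 0 * exp (- ((A * R) * x))) * (y ^ 2 * exp (- ((B * R) * y))))) \<partial>lborel \<partial>lborel)"
  proof (intro nn_integral_mono)
    fix x y :: real
    show "(indicator {0..} x * indicator {0..} y) * ennreal ((x ^ 0 * exp (- ((A * R) * x))) * (y ^ 0 * exp (- ((B * R) * y))))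
      \<le> ((indicator {0..} x * indicator {0..} y) * ennreal (exp (- (A * R * x)) * exp (- (B * R * y)) * weight R x y)
       + ennreal (a / 2) * ((indicator {0..} x * indicator {0..} y) * ennreal ((x ^ 2 * exp (- ((A * R) * x))) * (y ^ 0 * exp (- ((B * R) * y))))))
       + ennreal (b / 2) * ((indicator {0..} x * indicator {0..} y) * ennreal ((x ^ 0 * exp (- ((A * R) * x))) * (y ^ 2 * exp (- ((B * R) * y)))))"
    proof (cases "0 \<le> x \<and> 0 \<le> y")
      case True
      define E where "E = exp (- (A * R * x)) * exp (- (B * R * y))"
      have "1 * 1 * exp (- excess x y) \<le> weight R x y" unfolding weight_def
        using True R pos by (intro mult_mono ge_one_powr_ge_zero) auto
      moreover have "excess x y \<le> a / 2 * x\<^sup>2 + b / 2 * y\<^sup>2" using excess_le[of x y] True by (simp add: add_divide_distrib)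
      ultimately have "1 \<le> weight R x y + (a / 2 * x\<^sup>2 + b / 2 * y\<^sup>2)"
        using exp_ge_add_one_self[of "- excess x y"] by linarith
      then have "E * 1 \<le> E * (weight R x y + (a / 2 * x\<^sup>2 + b / 2 * y\<^sup>2))"
        by (intro mult_left_mono) (auto simp: E_def)
      then have "ennreal E \<le> ennreal (E * weight R x y + a / 2 * (x\<^sup>2 * E) + b / 2 * (y\<^sup>2 * E))"
        by (intro ennreal_leI) (simp add: algebra_simps)
      also have "\<dots> = ennreal (E * weight R x y) + ennreal (a / 2) * ennreal (x\<^sup>2 * E) + ennreal (b / 2) * ennreal (y\<^sup>2 * E)"
      proof -
        have E: "0 \<le> E" "0 \<le> weight R x y" by (auto simp: E_def weight_def)
        have "ennreal (E * weight R x y + a / 2 * (x\<^sup>2 * E) + b / 2 * (y\<^sup>2 * E)) = ennreal (E * weight R x y) + ennreal (a / 2 * (x\<^sup>2 * E)) + ennreal (b / 2 * (y\<^sup>2 * E))"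
          using E pos by (subst ennreal_plus, simp, simp)+ (rule refl)
        then show ?thesis using pos by (simp only: ennreal_mult'[of "a / 2"] ennreal_mult'[of "b / 2"] divide_nonneg_nonneg less_imp_le zero_le_numeral)
      qed
      finally show ?thesis using True by (simp add: E_def mult_ac)
    qed auto
  qed
  also have "\<dots> = X + ennreal (a / 2) * ennreal (2 / (A * R) ^ 3 * (1 / (B * R))) + ennreal (b / 2) * ennreal (1 / (A * R) * (2 / (B * R) ^ 3))"
  proof -
    have "(\<integral>\<^sup>+x. \<integral>\<^sup>+y. (indicator {0..} x * indicator {0..} y) * ennreal ((x ^ 2 * exp (- ((A * R) * x))) * (y ^ 0 * exp (- ((B * R) * y)))) \<partial>lborel \<partial>lborel)
       = ennreal (2 / (A * R) ^ 3 * (1 / (B * R)))"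
      using nn_integral_two_exp[OF AR, of 2 0] by (simp add: numeral_3_eq_3 numeral_2_eq_2)
    moreover have "(\<integral>\<^sup>+x. \<integral>\<^sup>+y. (indicator {0..} x * indicator {0..} y) * ennreal ((x ^ 0 * exp (- ((A * R) * x))) * (y ^ 2 * exp (- ((B * R) * y)))) \<partial>lborel \<partial>lborel)
       = ennreal (1 / (A * R) * (2 / (B * R) ^ 3))"
      using nn_integral_two_exp[OF AR, of 0 2] by (simp add: numeral_3_eq_3 numeral_2_eq_2)
    moreover have [measurable]: "(\<lambda>x. weight R (f x) (g x)) \<in> borel_measurable M" if "f \<in> borel_measurable M" "g \<in> borel_measurable M" for M :: "'z measure" and f g
      using that unfolding weight_def excess_def by measurable
    ultimately show ?thesis
      by (simp add: X_def nn_integral_add nn_integral_cmult)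
  qed
  finally have "ennreal (1 / (A * R) * (1 / (B * R))) \<le> X + ennreal (a / 2 * (2 / (A * R) ^ 3 * (1 / (B * R))) + b / 2 * (1 / (A * R) * (2 / (B * R) ^ 3)))"
    using pos AR by (subst ennreal_plus, simp, simp)
      (simp only: ennreal_mult'[of "a / 2"] ennreal_mult'[of "b / 2"] divide_nonneg_nonneg less_imp_le zero_le_numeral add.assoc)
  then have "ennreal (1 / (A * R) * (1 / (B * R)) - (a / 2 * (2 / (A * R) ^ 3 * (1 / (B * R))) + b / 2 * (1 / (A * R) * (2 / (B * R) ^ 3)))) \<le> X"
    using pos AR by (intro ennreal_le_add_imp_diff_le) (auto intro!: add_nonneg_nonneg)
  then have "ennreal (peak R) * ennreal (1 / (A * R) * (1 / (B * R)) - (a / 2 * (2 / (A * R) ^ 3 * (1 / (B * R))) + b / 2 * (1 / (A * R) * (2 / (B * R) ^ 3)))) \<le> ennreal (peak R) * X"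
    by (rule mult_left_mono) simp
  also have "ennreal (peak R) * X = corner_integral R" using corner_integral_eq[OF R] by (simp add: X_def)
  also have "ennreal (peak R) * ennreal (1 / (A * R) * (1 / (B * R)) - (a / 2 * (2 / (A * R) ^ 3 * (1 / (B * R))) + b / 2 * (1 / (A * R) * (2 / (B * R) ^ 3))))
      = ennreal (corner_term R * (1 - (a / A\<^sup>2 + b / B\<^sup>2) / R\<^sup>2))"
  proof -
    have "peak R * (1 / (A * R) * (1 / (B * R)) - (a / 2 * (2 / (A * R) ^ 3 * (1 / (B * R))) + b / 2 * (1 / (A * R) * (2 / (B * R) ^ 3)))) = corner_term R * (1 - (a / A\<^sup>2 + b / B\<^sup>2) / R\<^sup>2)"
      using R AB by (simp add: corner_term_def field_simps power2_eq_square power3_eq_cube)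
    then show ?thesis by (subst ennreal_mult'[symmetric]) (auto simp: peak_def)
  qed
  finally show ?thesis .
qed

text \<open>
  The excess is dropped, and \<open>(1 + x/R)\<^sup>m \<le> e\<^bsup>m x / R\<^esup>\<close> turns the powers into a change of the exponential rates from \<open>A R\<close>
  to \<open>A R - m / R\<close>, which is a relative change of order \<open>1/R\<^sup>2\<close>. The hypotheses on \<open>R\<close> keep
  this change at or below one half.
\<close>

lemma corner_integral_upper:
  assumes R: "0 < R" "2 * m \<le> A * R\<^sup>2" "2 * m \<le> \<mu> * B * R\<^sup>2"
  shows "corner_integral R \<le> ennreal (corner_term R * (1 + (4 * (m / A) + 2 * (m / (\<mu> * B))) / R\<^sup>2))"
proof -
  define x0 y0 where "x0 = m / (A * R\<^sup>2)" and "y0 = m / (\<mu> * B * R\<^sup>2)"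
  have x0: "0 \<le> x0" "x0 \<le> 1/2" and y0: "0 \<le> y0" "y0 \<le> 1/2"
    using R AB pos by (auto simp: x0_def y0_def field_simps)
  define s t where "s = A * R * (1 - x0)" and "t = B * R * (1 - y0)"
  have st: "0 < s" "0 < t" using R AB x0 y0 by (auto simp: s_def t_def)
  have powle: "(1 + z) powr m \<le> exp (m * z)" if "0 \<le> z" for z
  proof -
    have "(1 + z) powr m \<le> exp z powr m" using that pos by (intro powr_mono2 exp_ge_add_one_self) auto
    then show ?thesis by (simp add: powr_def)
  qed
  have "corner_integral R \<le> ennreal (peak R) * (\<integral>\<^sup>+x. \<integral>\<^sup>+y. (indicator {0..} x * indicator {0..} y) * ennreal ((x ^ 0 * exp (- (s * x))) * (y ^ 0 * exp (- (t * y)))) \<partial>lborel \<partial>lborel)"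
    unfolding corner_integral_eq[OF R(1)]
  proof (rule mult_left_mono, intro nn_integral_mono)
    fix x y :: real
    show "(indicator {0..} x * indicator {0..} y) * ennreal (exp (- (A * R * x)) * exp (- (B * R * y)) * weight R x y)
       \<le> (indicator {0..} x * indicator {0..} y) * ennreal ((x ^ 0 * exp (- (s * x))) * (y ^ 0 * exp (- (t * y))))"
    proof (cases "0 \<le> x \<and> 0 \<le> y")
      case True
      have "weight R x y \<le> exp (m * (x / R)) * exp (m * (y / (\<mu> * R))) * 1"
        unfolding weight_def using True R pos excess_nonneg[of x y] by (intro mult_mono powle) auto
      then have "exp (- (A * R * x)) * exp (- (B * R * y)) * weight R x y \<le> exp (- (A * R * x)) * exp (- (B * R * y)) * (exp (m * (x / R)) * exp (m * (y / (\<mu> * R))) * 1)"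
        by (intro mult_left_mono) auto
      also have "\<dots> = exp (- (s * x)) * exp (- (t * y))"
      proof -
        have "s * x = A * R * x - m * (x / R)" "t * y = B * R * y - m * (y / (\<mu> * R))"
          using R AB pos by (auto simp: s_def t_def x0_def y0_def field_simps power2_eq_square)
        then show ?thesis by (simp add: exp_add[symmetric] exp_diff exp_minus field_simps)
      qed
      finally show ?thesis using True by (simp add: ennreal_leI)
    qed auto
  qed simp
  also have "\<dots> = ennreal (peak R * (1 / s * (1 / t)))"
    unfolding nn_integral_two_exp[OF st] by (subst ennreal_mult'[symmetric]) (auto simp: peak_def)
  also have "\<dots> \<le> ennreal (corner_term R * (1 + (4 * (m / A) + 2 * (m / (\<mu> * B))) / R\<^sup>2))"
  proof (rule ennreal_leI)
    have inv: "1 / (1 - z) \<le> 1 + 2 * z" if "0 \<le> z" "z \<le> 1/2" for z :: real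
    proof -
      have "0 \<le> z * (1 - 2 * z)" using that by simp
      then show ?thesis using that by (simp add: field_simps)
    qed
    have "peak R * (1 / s * (1 / t)) = corner_term R * (1 / (1 - x0) * (1 / (1 - y0)))"
      by (simp add: corner_term_def s_def t_def power2_eq_square mult_ac)
    also have "\<dots> \<le> corner_term R * ((1 + 2 * x0) * (1 + 2 * y0))"
      using x0 y0 AB by (intro mult_left_mono mult_mono inv) (auto simp: corner_term_def peak_def)
    also have "\<dots> \<le> corner_term R * (1 + 4 * x0 + 2 * y0)"
    proof (intro mult_left_mono)
      have "x0 * y0 \<le> x0 * (1/2)" using x0 y0 by (intro mult_left_mono) auto
      then show "(1 + 2 * x0) * (1 + 2 * y0) \<le> 1 + 4 * x0 + 2 * y0" by (simp add: algebra_simps)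
    qed (use AB in \<open>auto simp: corner_term_def peak_def\<close>)
    also have "1 + 4 * x0 + 2 * y0 = 1 + (4 * (m / A) + 2 * (m / (\<mu> * B))) / R\<^sup>2"
      by (simp add: x0_def y0_def add_divide_distrib)
    finally show "peak R * (1 / s * (1 / t)) \<le> corner_term R * (1 + (4 * (m / A) + 2 * (m / (\<mu> * B))) / R\<^sup>2)" .
  qed
  finally show ?thesis .
qed

end

section \<open>The two radii of a Brownian motion\<close>

lemma prod_normal_density:
  fixes x :: "'a::euclidean_space"
  assumes "0 < t"
  shows "(\<Prod>b\<in>Basis. normal_density 0 (sqrt t) (x \<bullet> b)) = (2 * pi * t) powr (- real DIM('a) / 2) * exp (- (norm x)\<^sup>2 / (2 * t))"
proof -
  have "(\<Prod>b\<in>Basis. normal_density 0 (sqrt t) (x \<bullet> b)) = (\<Prod>b\<in>(Basis::'a set). 1 / sqrt (2 * pi * t)) * (\<Prod>b\<in>Basis. exp (- (x \<bullet> b)\<^sup>2 / (2 * t)))"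
    using assms by (simp add: normal_density_def prod.distrib[symmetric] del: prod_constant)
  also have "(\<Prod>b\<in>Basis. exp (- (x \<bullet> b)\<^sup>2 / (2 * t))) = exp (- (norm x)\<^sup>2 / (2 * t))"
  proof -
    have "(norm x)\<^sup>2 = (\<Sum>b\<in>Basis. (x \<bullet> b)\<^sup>2)"
      unfolding power2_norm_eq_inner by (subst euclidean_inner) (simp add: power2_eq_square)
    then show ?thesis by (simp add: exp_sum[symmetric] sum_divide_distrib sum_negf)
  qed
  also have "(\<Prod>b\<in>(Basis::'a set). 1 / sqrt (2 * pi * t)) = (2 * pi * t) powr (- real DIM('a) / 2)"
  proof -
    have "1 / sqrt (2 * pi * t) = (2 * pi * t) powr (- (1/2))"
      using assms by (simp add: powr_minus powr_half_sqrt field_simps)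
    then have "(\<Prod>b\<in>(Basis::'a set). 1 / sqrt (2 * pi * t)) = ((2 * pi * t) powr (- (1/2))) powr real DIM('a)"
      using assms by (simp add: powr_realpow)
    then show ?thesis by (simp add: powr_powr)
  qed
  finally show ?thesis .
qed

context standard_brownian_motion
begin

text \<open>
  The increments over \<open>[0, s1]\<close> and \<open>[s1, s2]\<close> are used instead of the values of \<open>B\<close>, since independence and the
  Gaussian law are known for increments only.
\<close>

lemma increments_joint_density:
  assumes "0 < s1" "s1 < s2"
  shows "distributed M (lborel \<Otimes>\<^sub>M lborel) (\<lambda>\<omega>. (B s1 \<omega> - B 0 \<omega>, B s2 \<omega> - B s1 \<omega>))
    (\<lambda>(x, z). ennreal (\<Prod>b\<in>Basis. normal_density 0 (sqrt (s1 - 0)) (x \<bullet> b)) * ennreal (\<Prod>b\<in>Basis. normal_density 0 (sqrt (s2 - s1)) (z \<bullet> b)))"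
proof -
  define t where "t i = (if i = 0 then 0 else if i = Suc 0 then s1 else s2)" for i :: nat
  have t: "t 0 = 0" "t (Suc 0) = s1" "t (Suc (Suc 0)) = s2" by (simp_all add: t_def)
  have iv: "indep_vars (\<lambda>_. borel) (\<lambda>i \<omega>. B (t (Suc i)) \<omega> - B (t i) \<omega>) {..<2}"
    using assms by (intro independent_increments) (auto simp: t_def less_2_cases_iff)
  have "indep_var (PiM {0} (\<lambda>_. borel)) (\<lambda>\<omega>. restrict (\<lambda>i. B (t (Suc i)) \<omega> - B (t i) \<omega>) {0})
     (PiM {1} (\<lambda>_. borel)) (\<lambda>\<omega>. restrict (\<lambda>i. B (t (Suc i)) \<omega> - B (t i) \<omega>) {1})"
    by (rule indep_var_restrict[OF iv]) auto
  then have "indep_var lborel ((\<lambda>f. f 0) \<circ> (\<lambda>\<omega>. restrict (\<lambda>i. B (t (Suc i)) \<omega> - B (t i) \<omega>) {0}))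
     lborel ((\<lambda>f. f 1) \<circ> (\<lambda>\<omega>. restrict (\<lambda>i. B (t (Suc i)) \<omega> - B (t i) \<omega>) {1}))"
    by (rule indep_var_compose) (auto simp: measurable_lborel2 intro!: measurable_component_singleton)
  then have "indep_var lborel (\<lambda>\<omega>. B s1 \<omega> - B 0 \<omega>) lborel (\<lambda>\<omega>. B s2 \<omega> - B s1 \<omega>)"
    by (simp add: comp_def t)
  then show ?thesis
    using assms by (intro distributed_joint_indep gaussian_increments sigma_finite_lborel) auto
qed

text \<open>
  Shift the second increment \<open>z\<close> by \<open>x\<close>, so that \<open>y = x + z\<close> is the position at time \<open>s2\<close>, and expand the square in the
  density of \<open>y - x\<close>.
\<close>

lemma emeasure_bessel_ge:
  assumes "0 < s1" "s1 < s2"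
  shows "emeasure M {\<omega> \<in> space M. x1 \<le> bessel B s1 \<omega> \<and> x2 \<le> bessel B s2 \<omega>}
    = ennreal ((2 * pi * s1) powr (- real DIM('a) / 2) * (2 * pi * (s2 - s1)) powr (- real DIM('a) / 2)) *
      (\<integral>\<^sup>+x. \<integral>\<^sup>+y. indicator {x1..} (norm (x::'a)) * indicator {x2..} (norm (y::'a)) *
        ennreal (exp (- ((1 / s1 + 1 / (s2 - s1)) * (norm x)\<^sup>2 + 1 / (s2 - s1) * (norm y)\<^sup>2) / 2 + 1 / (s2 - s1) * (y \<bullet> x))) \<partial>lborel \<partial>lborel)"
proof -
  have [measurable]: "B s1 \<in> borel_measurable M" "B s2 \<in> borel_measurable M" "B 0 \<in> borel_measurable M"
    using assms by (auto intro!: measurable)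
  define C where "C = (2 * pi * s1) powr (- real DIM('a) / 2) * (2 * pi * (s2 - s1)) powr (- real DIM('a) / 2)"
  define p1 where "p1 x = ennreal (\<Prod>b\<in>Basis. normal_density 0 (sqrt (s1 - 0)) (x \<bullet> b))" for x :: 'a
  define p2 where "p2 x = ennreal (\<Prod>b\<in>Basis. normal_density 0 (sqrt (s2 - s1)) (x \<bullet> b))" for x :: 'a
  have [measurable]: "p1 \<in> borel_measurable borel" "p2 \<in> borel_measurable borel"
    unfolding p1_def p2_def by simp_all
  define h where "h = (\<lambda>(x::'a, z::'a). indicator {x1..} (norm x) * indicator {x2..} (norm (x + z)) :: ennreal)"
  have [measurable]: "h \<in> borel_measurable (borel \<Otimes>\<^sub>M borel)" unfolding h_def by measurable
  have "emeasure M {\<omega> \<in> space M. x1 \<le> bessel B s1 \<omega> \<and> x2 \<le> bessel B s2 \<omega>}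
      = emeasure M {\<omega> \<in> space M. x1 \<le> norm (B s1 \<omega> - B 0 \<omega>) \<and> x2 \<le> norm ((B s1 \<omega> - B 0 \<omega>) + (B s2 \<omega> - B s1 \<omega>))}"
    using start by (intro emeasure_eq_AE) (auto simp: bessel_def)
  also have "\<dots> = (\<integral>\<^sup>+\<omega>. h (B s1 \<omega> - B 0 \<omega>, B s2 \<omega> - B s1 \<omega>) \<partial>M)"
    by (subst nn_integral_indicator[symmetric], measurable) (intro nn_integral_cong, auto simp: h_def indicator_def)
  also have "\<dots> = (\<integral>\<^sup>+w. (\<lambda>(x, z). p1 x * p2 z) w * h w \<partial>(lborel \<Otimes>\<^sub>M lborel))"
    using distributed_nn_integral[OF increments_joint_density[OF assms], of h] unfolding p1_def p2_def by simp
  also have "\<dots> = (\<integral>\<^sup>+x. \<integral>\<^sup>+z. p1 x * p2 z * h (x, z) \<partial>lborel \<partial>lborel)"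
    by (subst lborel.nn_integral_fst[symmetric]) auto
  also have "\<dots> = (\<integral>\<^sup>+x. \<integral>\<^sup>+y. p1 x * p2 (y - x) * h (x, y - x) \<partial>lborel \<partial>lborel)"
  proof (rule nn_integral_cong)
    fix x :: 'a
    have "(\<integral>\<^sup>+y. p1 x * p2 (y - x) * h (x, y - x) \<partial>lborel) = (\<integral>\<^sup>+y. p1 x * p2 (y - x) * h (x, y - x) \<partial>distr lborel borel ((+) x))"
      by (simp add: lborel_distr_plus)
    also have "\<dots> = (\<integral>\<^sup>+z. p1 x * p2 z * h (x, z) \<partial>lborel)"
      by (subst nn_integral_distr) auto
    finally show "(\<integral>\<^sup>+z. p1 x * p2 z * h (x, z) \<partial>lborel) = (\<integral>\<^sup>+y. p1 x * p2 (y - x) * h (x, y - x) \<partial>lborel)" ..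
  qed
  also have "\<dots> = (\<integral>\<^sup>+x. \<integral>\<^sup>+y. ennreal C * (indicator {x1..} (norm (x::'a)) * indicator {x2..} (norm (y::'a)) *
        ennreal (exp (- ((1 / s1 + 1 / (s2 - s1)) * (norm x)\<^sup>2 + 1 / (s2 - s1) * (norm y)\<^sup>2) / 2 + 1 / (s2 - s1) * (y \<bullet> x)))) \<partial>lborel \<partial>lborel)"
  proof (intro nn_integral_cong)
    fix x y :: 'a
    define c1 c2 where "c1 = (2 * pi * s1) powr (- real DIM('a) / 2)" and "c2 = (2 * pi * (s2 - s1)) powr (- real DIM('a) / 2)"
    define E1 E2 where "E1 = exp (- (norm x)\<^sup>2 / (2 * s1))" and "E2 = exp (- (norm (y - x))\<^sup>2 / (2 * (s2 - s1)))"
    have E: "E1 * E2 = exp (- ((1 / s1 + 1 / (s2 - s1)) * (norm x)\<^sup>2 + 1 / (s2 - s1) * (norm y)\<^sup>2) / 2 + 1 / (s2 - s1) * (y \<bullet> x))"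
    proof -
      have n: "(norm (y - x))\<^sup>2 = (norm y)\<^sup>2 + (norm x)\<^sup>2 - 2 * (y \<bullet> x)"
        by (simp add: power2_norm_eq_inner inner_diff_left inner_diff_right inner_commute)
      define T where "T = s2 - s1"
      have "0 < T" using assms by (simp add: T_def)
      then show ?thesis
        unfolding E1_def E2_def n T_def[symmetric] exp_add[symmetric] using assms by (simp add: field_simps)
    qed
    then have "p1 x * p2 (y - x) = ennreal C * ennreal (exp (- ((1 / s1 + 1 / (s2 - s1)) * (norm x)\<^sup>2 + 1 / (s2 - s1) * (norm y)\<^sup>2) / 2 + 1 / (s2 - s1) * (y \<bullet> x)))"
    proof -
      have "p1 x = ennreal (c1 * E1)" "p2 (y - x) = ennreal (c2 * E2)"
        using assms by (simp_all add: p1_def p2_def prod_normal_density c1_def c2_def E1_def E2_def)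
      then have "p1 x * p2 (y - x) = ennreal ((c1 * E1) * (c2 * E2))"
        by (simp add: ennreal_mult'[symmetric] c1_def c2_def E1_def E2_def)
      also have "(c1 * E1) * (c2 * E2) = C * (E1 * E2)" by (simp add: C_def c1_def c2_def)
      also have "ennreal (C * (E1 * E2)) = ennreal C * ennreal (E1 * E2)"
        by (rule ennreal_mult') (simp add: C_def)
      finally show ?thesis unfolding E .
    qed
    then show "p1 x * p2 (y - x) * h (x, y - x) = ennreal C * (indicator {x1..} (norm x) * indicator {x2..} (norm y) *
        ennreal (exp (- ((1 / s1 + 1 / (s2 - s1)) * (norm x)\<^sup>2 + 1 / (s2 - s1) * (norm y)\<^sup>2) / 2 + 1 / (s2 - s1) * (y \<bullet> x))))"
      by (simp add: h_def mult_ac)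
  qed
  finally show ?thesis unfolding C_def by (simp add: nn_integral_cmult)
qed

end

text \<open>
  For fixed \<open>x\<close> the integral over \<open>y\<close> is taken in spherical coordinates around \<open>x\<close>, where the angular part is
  \<open>e\<^bsup>\<kappa> u v\<^esup> scaled_bessel (\<kappa> u v)\<close>; the result depends on \<open>|x|\<close> only and is integrated radially.
\<close>

lemma nn_integral_Gauss_outside_balls:
  fixes a b \<kappa> x1 x2 :: real
  assumes n: "DIM('a::euclidean_space) = Suc (Suc n)" and x: "0 < x1" "0 < x2"
  shows "(\<integral>\<^sup>+x. \<integral>\<^sup>+y. indicator {x1..} (norm (x::'a)) * indicator {x2..} (norm (y::'a)) *
        ennreal (exp (- (a * (norm x)\<^sup>2 + b * (norm y)\<^sup>2) / 2 + \<kappa> * (y \<bullet> x))) \<partial>lborel \<partial>lborel)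
    = ennreal (real (Suc (Suc n)) * unit_ball_vol (real (Suc (Suc n))) * (real (Suc n) * unit_ball_vol (real (Suc n)))) *
      (\<integral>\<^sup>+u. \<integral>\<^sup>+v. indicator {x1..} u * indicator {x2..} v *
        ennreal ((u * v) ^ Suc n * exp (- ((a * u\<^sup>2 + b * v\<^sup>2) / 2 - \<kappa> * (u * v)))) * scaled_bessel ((real n - 1) / 2) (\<kappa> * (u * v)) \<partial>lborel \<partial>lborel)"
proof -
  obtain e :: 'a where e: "e \<in> Basis" by (meson ex_in_conv nonempty_Basis)
  define K1 where "K1 = real (Suc (Suc n)) * unit_ball_vol (real (Suc (Suc n)))"
  define K2 where "K2 = real (Suc n) * unit_ball_vol (real (Suc n))"
  have K: "0 \<le> K1" "0 \<le> K2" by (simp_all add: K1_def K2_def)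
  have [measurable]: "(\<lambda>x. scaled_bessel \<alpha> (f x)) \<in> borel_measurable M'" if [measurable]: "f \<in> borel_measurable M'" for \<alpha> f and M' :: "'z measure"
  proof -
    have "scaled_bessel \<alpha> \<in> borel_measurable borel" unfolding scaled_bessel_def by measurable
    then show ?thesis using that by simp
  qed
  define \<alpha> where "\<alpha> = (real n - 1) / 2"
  define H where "H u = (\<integral>\<^sup>+v. indicator {x1..} u * (indicator {x2..} v *
      ennreal (v ^ Suc n * exp (- ((a * u\<^sup>2 + b * v\<^sup>2) / 2 - \<kappa> * (u * v))))) * scaled_bessel \<alpha> (\<kappa> * (u * v)) \<partial>lborel)" for u
  have [measurable]: "H \<in> borel_measurable borel" unfolding H_def by measurable
  have inner: "(\<integral>\<^sup>+y. indicator {x1..} (norm x) * indicator {x2..} (norm y) *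
        ennreal (exp (- (a * (norm x)\<^sup>2 + b * (norm y)\<^sup>2) / 2 + \<kappa> * (y \<bullet> x))) \<partial>lborel) = ennreal K2 * H (norm x)" for x :: 'a
  proof -
    define u where "u = norm x"
    define g where "g v t = indicator {x1..} u * indicator {x2..} v * ennreal (exp (- (a * u\<^sup>2 + b * v\<^sup>2) / 2 + \<kappa> * t))" for v t :: real
    have [measurable]: "(\<lambda>x. g (f x) (f' x)) \<in> borel_measurable M'" if "f \<in> borel_measurable M'" "f' \<in> borel_measurable M'" for f f' and M' :: "'z measure"
      using that unfolding g_def by measurable
    have "(\<integral>\<^sup>+y. g (norm y) (y \<bullet> x) \<partial>lborel) = (\<integral>\<^sup>+y. g (norm y) (y \<bullet> (u *\<^sub>R e)) \<partial>lborel)"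
      by (rule nn_integral_norm_inner_cong) (use e in \<open>simp_all add: u_def\<close>)
    also have "\<dots> = (\<integral>\<^sup>+y. (\<lambda>v t. g v (u * t)) (norm y) (y \<bullet> e) \<partial>lborel)" by simp
    also have "\<dots> = ennreal K2 * (\<integral>\<^sup>+v. indicator {0<..} v * ennreal (v ^ Suc n) *
        (\<integral>\<^sup>+s. indicator {0<..<2} s * ennreal ((s * (2 - s)) powr \<alpha>) * g v (u * (v * (1 - s))) \<partial>lborel) \<partial>lborel)"
      unfolding K2_def \<alpha>_def by (rule nn_integral_axial[OF e n]) measurable
    also have "(\<integral>\<^sup>+v. indicator {0<..} v * ennreal (v ^ Suc n) *
        (\<integral>\<^sup>+s. indicator {0<..<2} s * ennreal ((s * (2 - s)) powr \<alpha>) * g v (u * (v * (1 - s))) \<partial>lborel) \<partial>lborel) = H u"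
      unfolding H_def
    proof (rule nn_integral_cong)
      fix v :: real
      show "indicator {0<..} v * ennreal (v ^ Suc n) *
        (\<integral>\<^sup>+s. indicator {0<..<2} s * ennreal ((s * (2 - s)) powr \<alpha>) * g v (u * (v * (1 - s))) \<partial>lborel)
        = indicator {x1..} u * (indicator {x2..} v * ennreal (v ^ Suc n * exp (- ((a * u\<^sup>2 + b * v\<^sup>2) / 2 - \<kappa> * (u * v))))) * scaled_bessel \<alpha> (\<kappa> * (u * v))"
      proof (cases "x1 \<le> u \<and> x2 \<le> v")
        case True
        then have v: "0 < v" using x by linarith
        have "indicator {0<..<2} s * ennreal ((s * (2 - s)) powr \<alpha>) * g v (u * (v * (1 - s)))
           = ennreal (exp (- ((a * u\<^sup>2 + b * v\<^sup>2) / 2 - \<kappa> * (u * v)))) * (indicator {0<..<2} s * ennreal ((s * (2 - s)) powr \<alpha> * exp (- (\<kappa> * (u * v) * s))))" for s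
        proof -
          have "exp (- (a * u\<^sup>2 + b * v\<^sup>2) / 2 + \<kappa> * (u * (v * (1 - s)))) = exp (- ((a * u\<^sup>2 + b * v\<^sup>2) / 2 - \<kappa> * (u * v))) * exp (- (\<kappa> * (u * v) * s))"
            unfolding exp_add[symmetric] by (simp add: algebra_simps add_divide_distrib diff_divide_distrib)
          then have "g v (u * (v * (1 - s))) = ennreal (exp (- ((a * u\<^sup>2 + b * v\<^sup>2) / 2 - \<kappa> * (u * v)))) * ennreal (exp (- (\<kappa> * (u * v) * s)))"
            unfolding g_def using True by (simp add: ennreal_mult'[symmetric])
          then show ?thesis by (simp add: ennreal_mult' mult_ac)
        qed
        then have "(\<integral>\<^sup>+s. indicator {0<..<2} s * ennreal ((s * (2 - s)) powr \<alpha>) * g v (u * (v * (1 - s))) \<partial>lborel)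
           = ennreal (exp (- ((a * u\<^sup>2 + b * v\<^sup>2) / 2 - \<kappa> * (u * v)))) * scaled_bessel \<alpha> (\<kappa> * (u * v))"
          unfolding scaled_bessel_def by (simp only:) (rule nn_integral_cmult, measurable)
        then show ?thesis using True v by (simp add: ennreal_mult' mult.assoc)
      next
        case False
        then have "g v t = 0" for t by (auto simp: g_def)
        then show ?thesis using False by (auto simp: indicator_def)
      qed
    qed
    finally show ?thesis by (simp add: g_def u_def)
  qed
  have "(\<integral>\<^sup>+x. \<integral>\<^sup>+y. indicator {x1..} (norm (x::'a)) * indicator {x2..} (norm (y::'a)) *
        ennreal (exp (- (a * (norm x)\<^sup>2 + b * (norm y)\<^sup>2) / 2 + \<kappa> * (y \<bullet> x))) \<partial>lborel \<partial>lborel)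
      = (\<integral>\<^sup>+x. ennreal K2 * H (norm (x::'a)) \<partial>lborel)"
    unfolding inner ..
  also have "\<dots> = ennreal K2 * (\<integral>\<^sup>+x. H (norm (x::'a)) \<partial>lborel)"
    by (rule nn_integral_cmult) measurable
  also have "(\<integral>\<^sup>+x. H (norm (x::'a)) \<partial>lborel) = ennreal K1 * (\<integral>\<^sup>+u. indicator {0<..} u * ennreal (u ^ (Suc (Suc n) - 1)) * H u \<partial>lborel)"
    unfolding K1_def
  proof (rule nn_integral_radial)
    show "emeasure lborel {x \<in> space lborel. norm (x::'a) \<le> r} = ennreal (unit_ball_vol (real (Suc (Suc n))) * r ^ Suc (Suc n))" if "0 < r" for r
      using emeasure_cball[of r "0::'a"] that unfolding n by (simp add: cball_def)
  qed auto
  also have "(\<integral>\<^sup>+u. indicator {0<..} u * ennreal (u ^ (Suc (Suc n) - 1)) * H u \<partial>lborel)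
    = (\<integral>\<^sup>+u. \<integral>\<^sup>+v. indicator {x1..} u * indicator {x2..} v *
        ennreal ((u * v) ^ Suc n * exp (- ((a * u\<^sup>2 + b * v\<^sup>2) / 2 - \<kappa> * (u * v)))) * scaled_bessel \<alpha> (\<kappa> * (u * v)) \<partial>lborel \<partial>lborel)"
  proof (rule nn_integral_cong)
    fix u :: real
    have "indicator {0<..} u * ennreal (u ^ (Suc (Suc n) - 1)) * H u =
      (\<integral>\<^sup>+v. (indicator {0<..} u * ennreal (u ^ Suc n)) * (indicator {x1..} u * (indicator {x2..} v *
      ennreal (v ^ Suc n * exp (- ((a * u\<^sup>2 + b * v\<^sup>2) / 2 - \<kappa> * (u * v))))) * scaled_bessel \<alpha> (\<kappa> * (u * v))) \<partial>lborel)"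
      unfolding H_def diff_Suc_1 by (rule nn_integral_cmult[symmetric]) measurable
    also have "\<dots> = (\<integral>\<^sup>+v. indicator {x1..} u * indicator {x2..} v *
        ennreal ((u * v) ^ Suc n * exp (- ((a * u\<^sup>2 + b * v\<^sup>2) / 2 - \<kappa> * (u * v)))) * scaled_bessel \<alpha> (\<kappa> * (u * v)) \<partial>lborel)"
    proof (rule nn_integral_cong)
      fix v :: real
      show "(indicator {0<..} u * ennreal (u ^ Suc n)) * (indicator {x1..} u * (indicator {x2..} v *
      ennreal (v ^ Suc n * exp (- ((a * u\<^sup>2 + b * v\<^sup>2) / 2 - \<kappa> * (u * v))))) * scaled_bessel \<alpha> (\<kappa> * (u * v))) = indicator {x1..} u * indicator {x2..} v *
        ennreal ((u * v) ^ Suc n * exp (- ((a * u\<^sup>2 + b * v\<^sup>2) / 2 - \<kappa> * (u * v)))) * scaled_bessel \<alpha> (\<kappa> * (u * v))"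
      proof (cases "x1 \<le> u")
        case True
        then have "0 < u" using x by linarith
        moreover have "ennreal ((u * v) ^ Suc n * exp (- ((a * u\<^sup>2 + b * v\<^sup>2) / 2 - \<kappa> * (u * v))))
          = ennreal (u ^ Suc n) * ennreal (v ^ Suc n * exp (- ((a * u\<^sup>2 + b * v\<^sup>2) / 2 - \<kappa> * (u * v))))"
          using \<open>0 < u\<close> by (subst ennreal_mult'[symmetric]) (simp_all add: power_mult_distrib mult_ac)
        ultimately show ?thesis using True by (simp only: indicator_simps greaterThan_iff atLeast_iff mult_1_left mult_ac)
      qed simp
    qed
    finally show "indicator {0<..} u * ennreal (u ^ (Suc (Suc n) - 1)) * H u = (\<integral>\<^sup>+v. indicator {x1..} u * indicator {x2..} v *
        ennreal ((u * v) ^ Suc n * exp (- ((a * u\<^sup>2 + b * v\<^sup>2) / 2 - \<kappa> * (u * v)))) * scaled_bessel \<alpha> (\<kappa> * (u * v)) \<partial>lborel)" .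
  qed
  finally show ?thesis
    using K by (simp only: K1_def[symmetric] K2_def[symmetric] \<alpha>_def[symmetric] ennreal_mult') (simp add: mult_ac)
qed

section \<open>Asymptotics of the two-radius integral\<close>

context quadratic_corner
begin

definition two_radius_integral where
  "two_radius_integral R = (\<integral>\<^sup>+u. \<integral>\<^sup>+v. indicator {R..} u * indicator {\<mu> * R..} v *
     ennreal ((u * v) powr (2 * m) * exp (- ((a * u\<^sup>2 + b * v\<^sup>2) / 2 - \<kappa> * (u * v)))) * scaled_bessel (m - 1) (\<kappa> * (u * v)) \<partial>lborel \<partial>lborel)"

definition kernel_const where "kernel_const = 2 powr (m - 1) * Gamma m * \<kappa> powr (- m)"

lemma corner_term_pos: "0 < R \<Longrightarrow> 0 < corner_term R"
  using AB pos by (simp add: corner_term_def peak_def)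

lemma kernel_const_pos: "1/2 \<le> m \<Longrightarrow> 0 < kernel_const"
  using pos by (auto simp: kernel_const_def intro!: mult_pos_pos Gamma_real_pos)

text \<open>
  The decay \<open>z\<^bsup>-m\<^esup>\<close> of the Bessel factor at \<open>z = \<kappa> u v\<close> cancels half of the exponent of \<open>(u v)\<^bsup>2m\<^esup>\<close>.
\<close>

lemma kernel_eq:
  assumes "0 < p"
  shows "p powr (2 * m) * E * (2 powr (m - 1) * Gamma m * (\<kappa> * p) powr (- m) * t) = kernel_const * t * (p powr m * E)"
proof -
  have "(\<kappa> * p) powr (- m) = \<kappa> powr (- m) * p powr (- m)" using pos assms by (simp add: powr_mult)
  moreover have "p powr (2 * m) * p powr (- m) = p powr m" using assms by (simp add: powr_add[symmetric])
  ultimately show ?thesis by (simp add: kernel_const_def mult_ac)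
qed

lemma corner_integral_factor:
  assumes "0 \<le> t"
  shows "ennreal (kernel_const * t) * corner_integral R = (\<integral>\<^sup>+u. \<integral>\<^sup>+v. ennreal (kernel_const * t) * (indicator {R..} u * indicator {\<mu> * R..} v *
      ennreal ((u * v) powr m * exp (- ((a * u\<^sup>2 + b * v\<^sup>2) / 2 - \<kappa> * (u * v))))) \<partial>lborel \<partial>lborel)"
  unfolding corner_integral_def by (simp add: nn_integral_cmult)

text \<open>
  Everywhere in the quadrant \<open>z = \<kappa> u v\<close> is at least \<open>\<kappa> \<mu> R\<^sup>2\<close>, so a relative error \<open>K / z\<close> in the Bessel factor is
  at most \<open>K / (\<kappa> \<mu> R\<^sup>2)\<close> and can be taken out of the integral.
\<close>

lemma two_radius_integral_bounds:
  assumes m: "1/2 \<le> m" and R: "1 \<le> R" "1 \<le> \<kappa> * \<mu> * R\<^sup>2"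
  shows "0 \<le> K \<Longrightarrow> (\<And>z. 1 \<le> z \<Longrightarrow> scaled_bessel (m - 1) z \<le> ennreal (2 powr (m - 1) * Gamma m * z powr (- m) * (1 + K / z))) \<Longrightarrow>
      two_radius_integral R \<le> ennreal (kernel_const * (1 + K / (\<kappa> * \<mu>) / R\<^sup>2)) * corner_integral R"
    and "0 \<le> K \<Longrightarrow> K / (\<kappa> * \<mu>) / R\<^sup>2 \<le> 1 \<Longrightarrow> (\<And>z. 1 \<le> z \<Longrightarrow> ennreal (2 powr (m - 1) * Gamma m * z powr (- m) * (1 - K / z)) \<le> scaled_bessel (m - 1) z) \<Longrightarrow>
      ennreal (kernel_const * (1 - K / (\<kappa> * \<mu>) / R\<^sup>2)) * corner_integral R \<le> two_radius_integral R"
proof -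
  have prodge: "\<mu> * R\<^sup>2 \<le> u * v" if "R \<le> u" "\<mu> * R \<le> v" for u v
  proof -
    have "R * (\<mu> * R) \<le> u * v" using that R pos by (intro mult_mono) auto
    then show ?thesis by (simp add: power2_eq_square mult_ac)
  qed
  have \<mu>R: "0 < \<mu> * R\<^sup>2" using R pos by auto
  have z: "1 \<le> \<kappa> * (u * v)" "0 < u * v" "K / (\<kappa> * (u * v)) \<le> K / (\<kappa> * \<mu>) / R\<^sup>2" 
    if "R \<le> u" "\<mu> * R \<le> v" "0 \<le> K" for u v K
  proof -
    have "\<kappa> * (\<mu> * R\<^sup>2) \<le> \<kappa> * (u * v)" using prodge[OF that(1,2)] pos by (intro mult_left_mono) auto
    then show "1 \<le> \<kappa> * (u * v)" using R by (simp add: mult_ac)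
    show "0 < u * v" using prodge[OF that(1,2)] \<mu>R by linarith
    have "K / (\<kappa> * (u * v)) \<le> K / (\<kappa> * (\<mu> * R\<^sup>2))"
      using \<open>\<kappa> * (\<mu> * R\<^sup>2) \<le> \<kappa> * (u * v)\<close> that(3) \<mu>R pos by (intro divide_left_mono) auto
    then show "K / (\<kappa> * (u * v)) \<le> K / (\<kappa> * \<mu>) / R\<^sup>2" by (simp add: mult_ac)
  qed
  have c0: "0 \<le> 2 powr (m - 1) * Gamma m * y powr (- m)" for y :: real
    using m by (auto intro!: mult_nonneg_nonneg Gamma_real_nonneg)
  {
    assume K: "0 \<le> K" and le: "\<And>z. 1 \<le> z \<Longrightarrow> scaled_bessel (m - 1) z \<le> ennreal (2 powr (m - 1) * Gamma m * z powr (- m) * (1 + K / z))"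
    define t where "t = 1 + K / (\<kappa> * \<mu>) / R\<^sup>2"
    have t: "0 \<le> t" using K pos by (simp add: t_def)
    show "two_radius_integral R \<le> ennreal (kernel_const * (1 + K / (\<kappa> * \<mu>) / R\<^sup>2)) * corner_integral R"
      unfolding t_def[symmetric] corner_integral_factor[OF t] unfolding two_radius_integral_def
    proof (intro nn_integral_mono)
      fix u v :: real
      define E where "E = exp (- ((a * u\<^sup>2 + b * v\<^sup>2) / 2 - \<kappa> * (u * v)))"
      have E: "0 \<le> E" by (simp add: E_def)
      have "ennreal ((u * v) powr (2 * m) * E) * scaled_bessel (m - 1) (\<kappa> * (u * v)) \<le> ennreal (kernel_const * t) * ennreal ((u * v) powr m * E)"
        if uv: "R \<le> u" "\<mu> * R \<le> v"
      proof -
        have "scaled_bessel (m - 1) (\<kappa> * (u * v)) \<le> ennreal (2 powr (m - 1) * Gamma m * (\<kappa> * (u * v)) powr (- m) * t)"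
          using le[OF z(1)[OF uv K]] z(3)[OF uv K] unfolding t_def
          by (elim order_trans) (intro ennreal_leI mult_left_mono c0, simp)
        then have "ennreal ((u * v) powr (2 * m) * E) * scaled_bessel (m - 1) (\<kappa> * (u * v))
           \<le> ennreal ((u * v) powr (2 * m) * E) * ennreal (2 powr (m - 1) * Gamma m * (\<kappa> * (u * v)) powr (- m) * t)"
          by (rule mult_left_mono) simp
        also have "\<dots> = ennreal ((u * v) powr (2 * m) * E * (2 powr (m - 1) * Gamma m * (\<kappa> * (u * v)) powr (- m) * t))"
          using E by (intro ennreal_mult'[symmetric]) auto
        also have "\<dots> = ennreal (kernel_const * t * ((u * v) powr m * E))"
          unfolding kernel_eq[OF z(2)[OF uv K]] ..
        also have "\<dots> = ennreal (kernel_const * t) * ennreal ((u * v) powr m * E)"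
          using t kernel_const_pos[OF m] by (intro ennreal_mult') auto
        finally show ?thesis .
      qed
      then show "indicator {R..} u * indicator {\<mu> * R..} v *
       ennreal ((u * v) powr (2 * m) * exp (- ((a * u\<^sup>2 + b * v\<^sup>2) / 2 - \<kappa> * (u * v)))) * scaled_bessel (m - 1) (\<kappa> * (u * v))
       \<le> ennreal (kernel_const * t) * (indicator {R..} u * indicator {\<mu> * R..} v *
        ennreal ((u * v) powr m * exp (- ((a * u\<^sup>2 + b * v\<^sup>2) / 2 - \<kappa> * (u * v)))))"
        unfolding E_def[symmetric] by (auto simp: indicator_def)
    qed
  }
  {
    assume K: "0 \<le> K" and K1: "K / (\<kappa> * \<mu>) / R\<^sup>2 \<le> 1"
      and le: "\<And>z. 1 \<le> z \<Longrightarrow> ennreal (2 powr (m - 1) * Gamma m * z powr (- m) * (1 - K / z)) \<le> scaled_bessel (m - 1) z"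
    define t where "t = 1 - K / (\<kappa> * \<mu>) / R\<^sup>2"
    have t: "0 \<le> t" using K1 by (simp add: t_def)
    show "ennreal (kernel_const * (1 - K / (\<kappa> * \<mu>) / R\<^sup>2)) * corner_integral R \<le> two_radius_integral R"
      unfolding t_def[symmetric] corner_integral_factor[OF t] unfolding two_radius_integral_def
    proof (intro nn_integral_mono)
      fix u v :: real
      define E where "E = exp (- ((a * u\<^sup>2 + b * v\<^sup>2) / 2 - \<kappa> * (u * v)))"
      have E: "0 \<le> E" by (simp add: E_def)
      have "ennreal (kernel_const * t) * ennreal ((u * v) powr m * E) \<le> ennreal ((u * v) powr (2 * m) * E) * scaled_bessel (m - 1) (\<kappa> * (u * v))"
        if uv: "R \<le> u" "\<mu> * R \<le> v"
      proof -
        have "ennreal (2 powr (m - 1) * Gamma m * (\<kappa> * (u * v)) powr (- m) * t) \<le> ennreal (2 powr (m - 1) * Gamma m * (\<kappa> * (u * v)) powr (- m) * (1 - K / (\<kappa> * (u * v))))"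
          using z(3)[OF uv K] unfolding t_def by (intro ennreal_leI mult_left_mono c0) simp
        also have "\<dots> \<le> scaled_bessel (m - 1) (\<kappa> * (u * v))" by (rule le[OF z(1)[OF uv K]])
        finally have "ennreal ((u * v) powr (2 * m) * E) * ennreal (2 powr (m - 1) * Gamma m * (\<kappa> * (u * v)) powr (- m) * t)
          \<le> ennreal ((u * v) powr (2 * m) * E) * scaled_bessel (m - 1) (\<kappa> * (u * v))"
          by (rule mult_left_mono) simp
        moreover have "ennreal ((u * v) powr (2 * m) * E) * ennreal (2 powr (m - 1) * Gamma m * (\<kappa> * (u * v)) powr (- m) * t) = ennreal ((u * v) powr (2 * m) * E * (2 powr (m - 1) * Gamma m * (\<kappa> * (u * v)) powr (- m) * t))"
          using E by (intro ennreal_mult'[symmetric]) auto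
        moreover have "\<dots> = ennreal (kernel_const * t * ((u * v) powr m * E))"
          unfolding kernel_eq[OF z(2)[OF uv K]] ..
        moreover have "\<dots> = ennreal (kernel_const * t) * ennreal ((u * v) powr m * E)"
          using t kernel_const_pos[OF m] by (intro ennreal_mult') auto
        ultimately show ?thesis by simp
      qed
      then show "ennreal (kernel_const * t) * (indicator {R..} u * indicator {\<mu> * R..} v *
        ennreal ((u * v) powr m * exp (- ((a * u\<^sup>2 + b * v\<^sup>2) / 2 - \<kappa> * (u * v)))))
       \<le> indicator {R..} u * indicator {\<mu> * R..} v *
       ennreal ((u * v) powr (2 * m) * exp (- ((a * u\<^sup>2 + b * v\<^sup>2) / 2 - \<kappa> * (u * v)))) * scaled_bessel (m - 1) (\<kappa> * (u * v))"
        unfolding E_def[symmetric] by (auto simp: indicator_def)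
    qed
  }
qed

lemma two_radius_integral_asymptotics:
  assumes m: "1/2 \<le> m"
  shows "\<exists>K\<ge>0. eventually (\<lambda>R. ennreal (kernel_const * corner_term R * (1 - K / R\<^sup>2)) \<le> two_radius_integral R \<and> two_radius_integral R \<le> ennreal (kernel_const * corner_term R * (1 + K / R\<^sup>2))) at_top"
proof -
  obtain K1 where K1: "0 \<le> K1" "\<And>z. 1 \<le> z \<Longrightarrow> scaled_bessel (m - 1) z \<le> ennreal (2 powr (m - 1) * Gamma m * z powr (- m) * (1 + K1 / z))"
    using scaled_bessel_upper[OF m] by blast
  define N where "N = nat \<lceil>m\<rceil>"
  have N: "1 \<le> N" "m - 1 \<le> real N" using m by (auto simp: N_def) linarith+
  define K2 where "K2 = real N * m / 2"
  have K2: "0 \<le> K2" using pos by (simp add: K2_def)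
  have K2': "ennreal (2 powr (m - 1) * Gamma m * z powr (- m) * (1 - K2 / z)) \<le> scaled_bessel (m - 1) z" if "1 \<le> z" for z
    using scaled_bessel_lower[OF m _ N, of z] that by (simp add: K2_def)
  define k1 k2 where "k1 = K1 / (\<kappa> * \<mu>)" and "k2 = K2 / (\<kappa> * \<mu>)"
  define j1 j2 where "j1 = 4 * (m / A) + 2 * (m / (\<mu> * B))" and "j2 = a / A\<^sup>2 + b / B\<^sup>2"
  have nn: "0 \<le> k1" "0 \<le> k2" "0 \<le> j1" "0 \<le> j2"
    using K1(1) K2 pos AB by (simp_all add: k1_def k2_def j1_def j2_def)
  define K where "K = k1 + j1 + k1 * j1 + k2 + j2"
  have sq: "filterlim (\<lambda>R::real. R\<^sup>2) at_top at_top"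
    by (intro filterlim_pow_at_top filterlim_ident) simp
  have large: "eventually (\<lambda>R. C \<le> D * R\<^sup>2) at_top" if "0 < D" for C D :: real
  proof -
    have "eventually (\<lambda>R::real. C / D \<le> R\<^sup>2) at_top" using sq by (simp add: filterlim_at_top)
    then show ?thesis by eventually_elim (use that in \<open>simp add: field_simps\<close>)
  qed
  \<comment> \<open>the bound on k2 makes the lower estimate of the Bessel factor nonnegative, so that it can be multiplied by that of the corner integral\<close>
  have "eventually (\<lambda>R. 1 \<le> R \<and> 1 \<le> \<kappa> * \<mu> * R\<^sup>2 \<and> k2 \<le> 1 * R\<^sup>2 \<and> 2 * m \<le> A * R\<^sup>2 \<and> 2 * m \<le> \<mu> * B * R\<^sup>2) at_top"
    using pos AB by (intro eventually_conj large eventually_ge_at_top) auto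
  then have "eventually (\<lambda>R. ennreal (kernel_const * corner_term R * (1 - K / R\<^sup>2)) \<le> two_radius_integral R \<and> two_radius_integral R \<le> ennreal (kernel_const * corner_term R * (1 + K / R\<^sup>2))) at_top"
  proof eventually_elim
    case (elim R)
    then have R: "1 \<le> R" "0 < R" "1 \<le> \<kappa> * \<mu> * R\<^sup>2" "1 \<le> R\<^sup>2" by auto
    have GM: "0 \<le> kernel_const * corner_term R" "0 < kernel_const" using kernel_const_pos[OF m] corner_term_pos[OF R(2)] by auto
    have "two_radius_integral R \<le> ennreal (kernel_const * (1 + k1 / R\<^sup>2)) * corner_integral R"
      unfolding k1_def by (rule two_radius_integral_bounds(1)[OF m R(1,3) K1])
    also have "\<dots> \<le> ennreal (kernel_const * (1 + k1 / R\<^sup>2)) * ennreal (corner_term R * (1 + j1 / R\<^sup>2))"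
      unfolding j1_def using elim R by (intro mult_left_mono corner_integral_upper) auto
    also have "\<dots> = ennreal (kernel_const * (1 + k1 / R\<^sup>2) * (corner_term R * (1 + j1 / R\<^sup>2)))"
      using nn GM by (intro ennreal_mult'[symmetric]) auto
    also have "\<dots> \<le> ennreal (kernel_const * corner_term R * (1 + K / R\<^sup>2))"
    proof (rule ennreal_leI)
      have "k1 * j1 / R\<^sup>2 / R\<^sup>2 \<le> k1 * j1 / R\<^sup>2 / 1"
        using R nn by (intro divide_left_mono) auto
      then have "(1 + k1 / R\<^sup>2) * (1 + j1 / R\<^sup>2) \<le> 1 + (k1 + j1 + k1 * j1) / R\<^sup>2"
        by (simp add: algebra_simps add_divide_distrib power2_eq_square)
      also have "\<dots> \<le> 1 + K / R\<^sup>2"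
        using nn by (intro add_left_mono divide_right_mono) (auto simp: K_def)
      finally have "kernel_const * corner_term R * ((1 + k1 / R\<^sup>2) * (1 + j1 / R\<^sup>2)) \<le> kernel_const * corner_term R * (1 + K / R\<^sup>2)"
        using GM by (intro mult_left_mono)
      then show "kernel_const * (1 + k1 / R\<^sup>2) * (corner_term R * (1 + j1 / R\<^sup>2)) \<le> kernel_const * corner_term R * (1 + K / R\<^sup>2)"
        by (simp add: mult_ac)
    qed
    finally have upper: "two_radius_integral R \<le> ennreal (kernel_const * corner_term R * (1 + K / R\<^sup>2))" .
    have k2R: "k2 / R\<^sup>2 \<le> 1" using elim R by (simp add: field_simps)
    have "ennreal (kernel_const * corner_term R * (1 - K / R\<^sup>2)) \<le> ennreal (kernel_const * (1 - k2 / R\<^sup>2) * (corner_term R * (1 - j2 / R\<^sup>2)))"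
    proof (rule ennreal_leI)
      have "1 - K / R\<^sup>2 \<le> 1 - (k2 + j2) / R\<^sup>2"
        using nn by (intro diff_left_mono divide_right_mono) (auto simp: K_def)
      also have "\<dots> \<le> (1 - k2 / R\<^sup>2) * (1 - j2 / R\<^sup>2)"
        using nn by (simp add: algebra_simps add_divide_distrib)
      finally have "kernel_const * corner_term R * (1 - K / R\<^sup>2) \<le> kernel_const * corner_term R * ((1 - k2 / R\<^sup>2) * (1 - j2 / R\<^sup>2))"
        using GM by (intro mult_left_mono)
      then show "kernel_const * corner_term R * (1 - K / R\<^sup>2) \<le> kernel_const * (1 - k2 / R\<^sup>2) * (corner_term R * (1 - j2 / R\<^sup>2))"
        by (simp add: mult_ac)
    qed
    also have "\<dots> = ennreal (kernel_const * (1 - k2 / R\<^sup>2)) * ennreal (corner_term R * (1 - j2 / R\<^sup>2))"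
      using k2R GM by (intro ennreal_mult') auto
    also have "\<dots> \<le> ennreal (kernel_const * (1 - k2 / R\<^sup>2)) * corner_integral R"
      unfolding j2_def using R by (intro mult_left_mono corner_integral_lower) auto
    also have "\<dots> \<le> two_radius_integral R"
      unfolding k2_def using k2R by (intro two_radius_integral_bounds(2)[OF m R(1,3) K2 _ K2']) (auto simp: k2_def)
    finally show ?case using upper by blast
  qed
  moreover have "0 \<le> K" using nn by (simp add: K_def)
  ultimately show ?thesis by blast
qed

end

section \<open>The leading term in the original parameters\<close>

lemma surface_measure_unit_ball:
  assumes "0 < k"
  shows "k * unit_ball_vol k = 2 * pi powr (k / 2) / Gamma (k / 2)"
proof -
  have G: "Gamma (k / 2 + 1) = k / 2 * Gamma (k / 2)"
    using assms by (intro Gamma_plus1) (auto elim!: nonpos_Ints_cases)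
  have "0 < Gamma (k / 2)" using assms by (intro Gamma_real_pos) simp
  then show ?thesis unfolding unit_ball_vol_def G using assms by (simp add: field_simps)
qed

text \<open>
  The left-hand side is the product of the Gaussian normalisation, the surface measures of two unit spheres,
  the constant of the Bessel factor, and the corner term. The exponents agree because \<open>\<rho> = c l\<close> and
  \<open>c\<^sup>2 = s1 / s2\<close>; the prefactors are compared separately for each base \<open>2\<close>, \<open>\<pi>\<close>, \<open>s1\<close>, \<open>s2 - s1\<close> and \<open>R\<close>.
\<close>

lemma leading_term_eq:
  fixes s1 s2 l m R c \<rho> x :: real
  assumes s: "0 < s1" "s1 < s2" and l: "1 < l" "l * s1 < s2" and m: "0 < m" and R: "0 < R"
    and c: "c = sqrt (s1 / s2)" and \<rho>: "\<rho> = c * l" and x: "x = R\<^sup>2 / s1"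
  defines "k \<equiv> 1 / (s2 - s1)"
  shows "(2 * pi * s1) powr (- (m + 1/2)) * (2 * pi * (s2 - s1)) powr (- (m + 1/2)) *
     (2 * pi powr (m + 1/2) / Gamma (m + 1/2) * (2 * pi powr m / Gamma m)) *
     (2 powr (m - 1) * Gamma m * k powr (- m)) *
     ((l * R\<^sup>2) powr m * exp (- (R\<^sup>2 * (1 / s1 + k + k * l\<^sup>2 - 2 * k * l) / 2)) / ((1 / s1 + k - k * l) * (k * l - k) * R\<^sup>2))
   = x powr (m - 1) * (\<rho> / (2 * c)) powr m * (1 - c\<^sup>2) powr (3 / 2) * exp (- (x / (2 * (1 - c\<^sup>2))) * (\<rho>\<^sup>2 - 2 * c * \<rho> + 1))
      / (sqrt pi * Gamma (m + 1/2) * (\<rho> - c) * (1 - c * \<rho>))"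
proof -
  define D w y q where "D = s2 - s1" and "w = s2 - l * s1" and "y = l - 1" and "q = - (m + 1/2)"
  have D: "0 < D" "0 < w" "0 < y" "0 < s2" using s l by (auto simp: D_def w_def y_def)
  have c0: "0 < c" "c\<^sup>2 = s1 / s2" using s D by (auto simp: c)
  have G: "0 < Gamma m" "0 < Gamma (m + 1/2)" using m by (auto intro!: Gamma_real_pos)
  have ex: "exp (- (R\<^sup>2 * (1 / s1 + k + k * l\<^sup>2 - 2 * k * l) / 2)) = exp (- (x / (2 * (1 - c\<^sup>2))) * (\<rho>\<^sup>2 - 2 * c * \<rho> + 1))"
  proof -
    have r: "\<rho>\<^sup>2 - 2 * c * \<rho> + 1 = (s1 * (l\<^sup>2 - 2 * l) + s2) / s2"
      using D c0 by (simp add: \<rho> power_mult_distrib) (simp add: power2_eq_square field_simps)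
    have e: "1 - c\<^sup>2 = D / s2" using D c0 by (simp add: D_def field_simps)
    have k: "1 / s1 + k + k * l\<^sup>2 - 2 * k * l = (s1 * (l\<^sup>2 - 2 * l) + s2) / (s1 * D)"
    proof -
      have "s2 = D + s1" by (simp add: D_def)
      then show ?thesis using s D(1) unfolding k_def D_def[symmetric] by (simp add: field_simps)
    qed
    show ?thesis unfolding r e k x using s D by (simp add: field_simps)
  qed
  have A: "1 / s1 + k - k * l = w / (s1 * D)" 
  proof -
    have "s2 = D + s1" by (simp add: D_def)
    then show ?thesis using s D(1) unfolding k_def w_def D_def[symmetric] by (simp add: field_simps)
  qed
  have B: "k * l - k = y / D" by (simp add: k_def y_def D_def diff_divide_distrib)
  have kp: "k powr (- m) = D powr m"
    using D by (simp add: k_def D_def[symmetric] powr_divide powr_minus)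
  have p2: "4 * (2 powr q * 2 powr q * 2 powr (m - 1)) = (2 powr (- m) :: real)"
  proof -
    have "4 * (2 powr q * 2 powr q * 2 powr (m - 1)) = (2 powr 2 * (2 powr q * 2 powr q * 2 powr (m - 1)) :: real)" by simp
    also have "\<dots> = 2 powr (- m)" unfolding powr_add[symmetric] by (simp add: q_def)
    finally show ?thesis .
  qed
  have ppi: "pi powr q * pi powr q * pi powr (m + 1/2) * pi powr m = 1 / sqrt pi"
  proof -
    have "pi powr q * pi powr q * pi powr (m + 1/2) * pi powr m = pi powr (- (1/2))"
      unfolding powr_add[symmetric] by (simp add: q_def)
    then show ?thesis by (simp add: powr_minus powr_half_sqrt field_simps)
  qed
  have ps: "s1 powr q * s1 = s1 powr (- (m - 1)) / sqrt s1"
  proof -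
    have "s1 powr q * s1 = s1 powr (q + 1)" using s by (simp add: powr_add)
    also have "q + 1 = - (m - 1) + (- (1/2))" by (simp add: q_def)
    also have "s1 powr \<dots> = s1 powr (- (m - 1)) / sqrt s1"
    proof -
      have "s1 powr (- (1/2)) = 1 / sqrt s1" using s by (simp add: powr_minus powr_half_sqrt field_simps)
      then show ?thesis unfolding powr_add by simp
    qed
    finally show ?thesis .
  qed
  have pD: "D powr q * D powr m * D\<^sup>2 = D powr (3/2)"
  proof -
    have "D powr q * D powr m * D\<^sup>2 = D powr q * D powr m * D powr 2" using D by simp
    also have "\<dots> = D powr (3/2)" unfolding powr_add[symmetric] by (simp add: q_def)
    finally show ?thesis .
  qed
  have pR: "(l * R\<^sup>2) powr m / R\<^sup>2 = l powr m * (R\<^sup>2) powr (m - 1)"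
    using R l by (simp add: powr_mult powr_diff)
  have "(2 * pi * s1) powr q * (2 * pi * D) powr q *
     (2 * pi powr (m + 1/2) / Gamma (m + 1/2) * (2 * pi powr m / Gamma m)) *
     (2 powr (m - 1) * Gamma m * D powr m) * ((l * R\<^sup>2) powr m / (w / (s1 * D) * (y / D) * R\<^sup>2))
    = (4 * (2 powr q * 2 powr q * 2 powr (m - 1))) * (pi powr q * pi powr q * pi powr (m + 1/2) * pi powr m)
      * (s1 powr q * s1) * (D powr q * D powr m * D\<^sup>2) * ((l * R\<^sup>2) powr m / R\<^sup>2) / (Gamma (m + 1/2) * w * y)"
  proof -
    have sp: "(2 * pi * s1) powr q = 2 powr q * pi powr q * s1 powr q" and Dp: "(2 * pi * D) powr q = 2 powr q * pi powr q * D powr q"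
      using s D by (simp_all add: powr_mult)
    have "(a2 * ap * as) * (a2 * ap * ad) * (2 * b1 / G1 * (2 * b2 / G0)) * (t * G0 * dm) * (f / (w / (s1 * D) * (y / D) * r))
        = (4 * (a2 * a2 * t)) * (ap * ap * b1 * b2) * (as * s1) * (ad * dm * D\<^sup>2) * (f / r) / (G1 * w * y)"
      if "0 < G0" "0 < G1" "0 < r" for a2 ap as ad b1 b2 G1 G0 t dm f r :: real
      using that D s by (simp add: divide_simps power2_eq_square)
    then show ?thesis unfolding sp Dp using G R by simp
  qed
  also have "\<dots> = (2 powr (- m)) * (1 / sqrt pi) * (s1 powr (- (m - 1)) / sqrt s1) * D powr (3/2) * (l powr m * (R\<^sup>2) powr (m - 1)) / (Gamma (m + 1/2) * w * y)"
    unfolding p2 ppi ps pD pR ..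
  also have "\<dots> = x powr (m - 1) * (\<rho> / (2 * c)) powr m * (1 - c\<^sup>2) powr (3 / 2)
      / (sqrt pi * Gamma (m + 1/2) * (\<rho> - c) * (1 - c * \<rho>))"
  proof -
    have "x powr (m - 1) = (R\<^sup>2) powr (m - 1) * s1 powr (- (m - 1))"
    proof -
      have "x powr (m - 1) = (R\<^sup>2) powr (m - 1) / s1 powr (m - 1)" unfolding x by (rule powr_divide)
      then show ?thesis unfolding powr_minus by (simp only: divide_inverse)
    qed
    moreover have "(\<rho> / (2 * c)) powr m = l powr m * 2 powr (- m)"
    proof -
      have "\<rho> / (2 * c) = l / 2" using c0 by (simp add: \<rho>)
      then have "(\<rho> / (2 * c)) powr m = l powr m / 2 powr m" by (simp only: powr_divide)
      then show ?thesis by (simp only: powr_minus divide_inverse)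
    qed
    moreover have "(1 - c\<^sup>2) powr (3/2) = D powr (3/2) / (s2 * sqrt s2)"
    proof -
      have "1 - c\<^sup>2 = D / s2" using D c0 by (simp add: D_def field_simps)
      moreover have "s2 powr (3/2) = s2 * sqrt s2"
        using D powr_add[of s2 1 "1/2"] by (simp add: powr_half_sqrt)
      ultimately show ?thesis using D by (simp add: powr_divide)
    qed
    moreover have "(\<rho> - c) * (1 - c * \<rho>) = sqrt s1 / sqrt s2 * y * (w / s2)"
    proof -
      have "1 - c * \<rho> = 1 - c\<^sup>2 * l" by (simp add: \<rho> power2_eq_square)
      also have "\<dots> = w / s2" using D c0 by (simp add: w_def field_simps)
      finally have "1 - c * \<rho> = w / s2" .
      moreover have "\<rho> - c = c * y" by (simp add: \<rho> y_def algebra_simps)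
      ultimately show ?thesis by (simp add: c real_sqrt_divide)
    qed
    moreover have "sqrt pi * Gamma (m + 1/2) * (\<rho> - c) * (1 - c * \<rho>) = sqrt pi * Gamma (m + 1/2) * ((\<rho> - c) * (1 - c * \<rho>))"
      by (simp add: mult.assoc)
    ultimately show ?thesis using D s G by (simp only:) (simp add: divide_simps)
  qed
  finally have prefactor: "(2 * pi * s1) powr q * (2 * pi * D) powr q *
     (2 * pi powr (m + 1/2) / Gamma (m + 1/2) * (2 * pi powr m / Gamma m)) *
     (2 powr (m - 1) * Gamma m * D powr m) * ((l * R\<^sup>2) powr m / (w / (s1 * D) * (y / D) * R\<^sup>2))
   = x powr (m - 1) * (\<rho> / (2 * c)) powr m * (1 - c\<^sup>2) powr (3 / 2) / (sqrt pi * Gamma (m + 1/2) * (\<rho> - c) * (1 - c * \<rho>))" .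
  define e where "e = exp (- (x / (2 * (1 - c\<^sup>2))) * (\<rho>\<^sup>2 - 2 * c * \<rho> + 1))"
  have pull_factor: "a * (p * e / r) = a * (p / r) * e" "(p * e) / r = (p / r) * e" for a p r :: real by simp_all
  show ?thesis
    unfolding ex A B kp D_def[symmetric] q_def[symmetric] e_def[symmetric] pull_factor(1)
    unfolding prefactor by (rule pull_factor(2)[symmetric])
qed

section \<open>The tail asymptotics of the Bessel process\<close>

theorem theorem4:
  fixes M :: "'w measure" and B :: "real \<Rightarrow> 'w \<Rightarrow> 'a::euclidean_space"
    and d :: nat and s1 s2 \<rho> c :: real
    and F :: "'i filter" and x1 x2 xs :: "'i \<Rightarrow> real"
  assumes "standard_brownian_motion M B"
    and "d = DIM('a)" and "d \<ge> 2"
    and "0 < s1" and "s1 < s2"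
    and "filterlim x1 at_top F" and "filterlim x2 at_top F"
    and "\<forall>\<^sub>F i in F. sqrt (s1 / s2) * (x2 i / x1 i) = \<rho>"
    and "\<forall>\<^sub>F i in F. 1 < x2 i / x1 i \<and> x2 i / x1 i < s2 / s1"
    and "c = sqrt (s1 / s2)"
    and "\<And>i. xs i = (x1 i)\<^sup>2 / s1"
  shows "\<exists>E. E \<in> O[F](\<lambda>i. ln (xs i) / xs i) \<and>
    (\<forall>\<^sub>F i in F.
      \<P>(\<omega> in M. bessel B s1 \<omega> \<ge> x1 i \<and> bessel B s2 \<omega> \<ge> x2 i) =
        (xs i powr ((real d - 3) / 2) * (\<rho> / (2 * c)) powr ((real d - 1) / 2)
          * (1 - c\<^sup>2) powr (3 / 2)
          * exp (- (xs i / (2 * (1 - c\<^sup>2))) * (\<rho>\<^sup>2 - 2 * c * \<rho> + 1)))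
        / (sqrt pi * Gamma (real d / 2) * (\<rho> - c) * (1 - c * \<rho>))
        * (1 + E i))"
\<comment> \<open>only on a proper filter do the eventual hypotheses say anything about the constant quotient of the thresholds\<close>
proof (cases "F = bot")
  case True
  then show ?thesis by (intro exI[of _ "\<lambda>_. 0"]) simp
next
  case False
  interpret standard_brownian_motion M B by fact
  obtain n where n: "DIM('a) = Suc (Suc n)" using assms(2,3) by (metis add_2_eq_Suc le_Suc_ex)
  have d: "real d = real n + 2" using n assms(2) by simp
  note s = \<open>0 < s1\<close> \<open>s1 < s2\<close>
  have c: "0 < c" "c\<^sup>2 = s1 / s2" using s by (auto simp: assms(10))
  define l where "l = \<rho> / c"
  have ratio: "\<forall>\<^sub>F i in F. x2 i / x1 i = l"
    using assms(8) by eventually_elim (use c in \<open>auto simp: l_def assms(10)[symmetric]\<close>)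
  have l: "1 < l" "l < s2 / s1"
  proof -
    have "\<forall>\<^sub>F i in F. 1 < l \<and> l < s2 / s1" using ratio assms(9) by eventually_elim auto
    then show "1 < l" "l < s2 / s1" using False by (auto simp: eventually_const_iff)
  qed
  define k where "k = 1 / (s2 - s1)"
  define m where "m = (real n + 1) / 2"
  have sl: "l * s1 < s2" using l(2) s by (simp add: field_simps)
  interpret Q: quadratic_corner "1 / s1 + k" k k l m
  proof
    show "0 < 1 / s1 + k" "0 < k" "0 < l" "0 \<le> m" using s l by (auto simp: k_def m_def add_pos_pos)
    have "0 \<le> 1 / s1 * k" using s by (simp add: k_def)
    then show "k\<^sup>2 \<le> (1 / s1 + k) * k" by (simp only: power2_eq_square distrib_right)
    have "1 / s1 + k - k * l = (s2 - l * s1) / (s1 * (s2 - s1))"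
    proof -
      define D where "D = s2 - s1"
      have "s2 = D + s1" "0 < D" using s by (simp_all add: D_def)
      then show ?thesis using s(1) unfolding k_def D_def[symmetric] by (simp add: field_simps)
    qed
    then show "0 < 1 / s1 + k - k * l" using s sl by simp
    have "0 < (l - 1) * k" using s l by (simp add: k_def)
    then show "0 < k * l - k" by (simp add: algebra_simps)
  qed
  define C where "C = (2 * pi * s1) powr (- real DIM('a) / 2) * (2 * pi * (s2 - s1)) powr (- real DIM('a) / 2) *
    (real (Suc (Suc n)) * unit_ball_vol (real (Suc (Suc n))) * (real (Suc n) * unit_ball_vol (real (Suc n))))"
  have C: "0 < C" unfolding C_def by (intro mult_pos_pos) (use s in simp_all)
  have prob: "emeasure M {\<omega> \<in> space M. bessel B s1 \<omega> \<ge> R \<and> bessel B s2 \<omega> \<ge> l * R} = ennreal C * Q.two_radius_integral R" if "0 < R" for R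
  proof -
    have "emeasure M {\<omega> \<in> space M. bessel B s1 \<omega> \<ge> R \<and> bessel B s2 \<omega> \<ge> l * R}
      = ennreal ((2 * pi * s1) powr (- real DIM('a) / 2) * (2 * pi * (s2 - s1)) powr (- real DIM('a) / 2)) *
        (ennreal (real (Suc (Suc n)) * unit_ball_vol (real (Suc (Suc n))) * (real (Suc n) * unit_ball_vol (real (Suc n)))) *
        (\<integral>\<^sup>+u. \<integral>\<^sup>+v. indicator {R..} u * indicator {l * R..} v *
        ennreal ((u * v) ^ Suc n * exp (- (((1 / s1 + k) * u\<^sup>2 + k * v\<^sup>2) / 2 - k * (u * v)))) * scaled_bessel ((real n - 1) / 2) (k * (u * v)) \<partial>lborel \<partial>lborel))"
      unfolding emeasure_bessel_ge[OF s] k_def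
      by (subst nn_integral_Gauss_outside_balls[OF n]) (use that l in auto)
    also have "(\<integral>\<^sup>+u. \<integral>\<^sup>+v. indicator {R..} u * indicator {l * R..} v *
        ennreal ((u * v) ^ Suc n * exp (- (((1 / s1 + k) * u\<^sup>2 + k * v\<^sup>2) / 2 - k * (u * v)))) * scaled_bessel ((real n - 1) / 2) (k * (u * v)) \<partial>lborel \<partial>lborel) = Q.two_radius_integral R"
      unfolding Q.two_radius_integral_def
    proof (intro nn_integral_cong)
      fix u v :: real
      have "(u * v) ^ Suc n = (u * v) powr (2 * m)" if "R \<le> u" "l * R \<le> v"
      proof -
        have "0 < u" "0 < l * R" using that \<open>0 < R\<close> l by auto
        then have "0 < u * v" using that by (intro mult_pos_pos) auto
        then have "(u * v) ^ Suc n = (u * v) powr real (Suc n)" by (rule powr_realpow[symmetric])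
        moreover have "real (Suc n) = 2 * m" by (simp add: m_def)
        ultimately show ?thesis by (simp only:)
      qed
      note pw = this
      have al: "(real n - 1) / 2 = m - 1" by (simp add: m_def diff_divide_distrib add_divide_distrib)
      show "indicator {R..} u * indicator {l * R..} v *
        ennreal ((u * v) ^ Suc n * exp (- (((1 / s1 + k) * u\<^sup>2 + k * v\<^sup>2) / 2 - k * (u * v)))) * scaled_bessel ((real n - 1) / 2) (k * (u * v))
        = indicator {R..} u * indicator {l * R..} v *
        ennreal ((u * v) powr (2 * m) * exp (- (((1 / s1 + k) * u\<^sup>2 + k * v\<^sup>2) / 2 - k * (u * v)))) * scaled_bessel (m - 1) (k * (u * v))"
      proof (cases "R \<le> u \<and> l * R \<le> v")
        case True
        then show ?thesis unfolding al pw[OF conjunct1[OF True] conjunct2[OF True]] by (intro refl)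
      next
        case False
        then have "indicator {R..} u * indicator {l * R..} v = (0::ennreal)" by (auto simp: indicator_def)
        then show ?thesis by (simp only: mult_zero_left)
      qed
    qed
    finally show ?thesis unfolding C_def by (subst ennreal_mult') (auto simp: mult.assoc)
  qed
  define T where "T = C * Q.kernel_const"
  have T: "0 < T" using C Q.kernel_const_pos by (simp add: T_def m_def)
  obtain K where K: "0 \<le> K" "eventually (\<lambda>R. ennreal (Q.kernel_const * Q.corner_term R * (1 - K / R\<^sup>2)) \<le> Q.two_radius_integral R \<and> Q.two_radius_integral R \<le> ennreal (Q.kernel_const * Q.corner_term R * (1 + K / R\<^sup>2))) at_top"
    using Q.two_radius_integral_asymptotics by (auto simp: m_def)
  define P where "P i = \<P>(\<omega> in M. bessel B s1 \<omega> \<ge> x1 i \<and> bessel B s2 \<omega> \<ge> x2 i)" for i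
  define E where "E i = P i / (T * Q.corner_term (x1 i)) - 1" for i
  have x1_pos: "\<forall>\<^sub>F i in F. 0 < x1 i" using assms(6) by (simp add: filterlim_at_top_dense)
  have E_le: "\<forall>\<^sub>F i in F. \<bar>E i\<bar> \<le> K / (x1 i)\<^sup>2"
    using x1_pos ratio filterlim_iff[THEN iffD1, OF assms(6), rule_format, OF K(2)]
  proof eventually_elim
    case (elim i)
    define R where "R = x1 i"
    have R: "0 < R" "x2 i = l * R" using elim by (auto simp: R_def field_simps)
    have Mp: "0 < T * Q.corner_term R" using T Q.corner_term_pos[OF R(1)] by simp
    have P: "ennreal (P i) = ennreal C * Q.two_radius_integral R"
      unfolding P_def using prob[OF R(1)] by (simp add: R(2) R_def[symmetric] emeasure_eq_measure)
    have "ennreal (P i) \<le> ennreal C * ennreal (Q.kernel_const * Q.corner_term R * (1 + K / R\<^sup>2))"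
      unfolding P using elim by (intro mult_left_mono) (auto simp: R_def)
    also have "\<dots> = ennreal (T * Q.corner_term R * (1 + K / R\<^sup>2))"
      using C by (simp add: ennreal_mult'[symmetric] T_def mult_ac)
    finally have "P i \<le> T * Q.corner_term R * (1 + K / R\<^sup>2)"
      using Mp K(1) by (subst (asm) ennreal_le_iff) auto
    then have "P i / (T * Q.corner_term R) \<le> 1 + K / R\<^sup>2" by (simp only: pos_divide_le_eq[OF Mp] mult.commute)
    then have "E i \<le> K / R\<^sup>2" unfolding E_def R_def[symmetric] by simp
    have "ennreal (T * Q.corner_term R * (1 - K / R\<^sup>2)) = ennreal C * ennreal (Q.kernel_const * Q.corner_term R * (1 - K / R\<^sup>2))"
      using C by (subst ennreal_mult'[symmetric]) (simp_all add: T_def mult.assoc)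
    also have "\<dots> \<le> ennreal (P i)"
      unfolding P using elim by (intro mult_left_mono) (auto simp: R_def)
    finally have "T * Q.corner_term R * (1 - K / R\<^sup>2) \<le> P i"
      by (subst (asm) ennreal_le_iff) (auto simp: P_def)
    then have "1 - K / R\<^sup>2 \<le> P i / (T * Q.corner_term R)" by (simp only: pos_le_divide_eq[OF Mp] mult.commute)
    then have "- (K / R\<^sup>2) \<le> E i" unfolding E_def R_def[symmetric] by simp
    with \<open>E i \<le> K / R\<^sup>2\<close> show ?case by (simp add: R_def abs_le_iff)
  qed
  have "E \<in> O[F](\<lambda>i. ln (xs i) / xs i)"
  proof (rule bigoI)
    \<comment> \<open>beyond this threshold xs i is at least e, so that its logarithm is at least 1\<close>
    have "\<forall>\<^sub>F i in F. max 1 (s1 * exp 1) \<le> x1 i" using assms(6) unfolding filterlim_at_top by blast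
    then show "\<forall>\<^sub>F i in F. norm (E i) \<le> K / s1 * norm (ln (xs i) / xs i)"
      using E_le
    proof eventually_elim
      case (elim i)
      have x: "1 \<le> x1 i" "s1 * exp 1 \<le> x1 i" using elim(1) by auto
      have "s1 * exp 1 \<le> x1 i * 1" using x by simp
      also have "\<dots> \<le> x1 i * x1 i" using x by (intro mult_left_mono) auto
      finally have e: "exp 1 \<le> xs i" unfolding assms(11) using s by (simp add: field_simps power2_eq_square)
      then have pos: "0 < xs i" using exp_gt_zero less_le_trans by blast
      have "1 \<le> ln (xs i)" using e pos by (simp add: ln_ge_iff)
      have "K / (x1 i)\<^sup>2 = K / s1 * (1 / xs i)" using s by (simp add: assms(11))
      also have "\<dots> \<le> K / s1 * (ln (xs i) / xs i)"
        using \<open>1 \<le> ln (xs i)\<close> pos s K(1) by (intro mult_left_mono divide_right_mono) auto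
      also have "\<dots> = K / s1 * norm (ln (xs i) / xs i)"
      proof -
        have "0 \<le> ln (xs i) / xs i" using \<open>1 \<le> ln (xs i)\<close> pos by (intro divide_nonneg_pos) linarith+
        then show ?thesis by (simp only: real_norm_def abs_of_nonneg)
      qed
      finally show ?case using elim by simp
    qed
  qed
  moreover have "\<forall>\<^sub>F i in F. P i = (xs i powr ((real d - 3) / 2) * (\<rho> / (2 * c)) powr ((real d - 1) / 2)
          * (1 - c\<^sup>2) powr (3 / 2)
          * exp (- (xs i / (2 * (1 - c\<^sup>2))) * (\<rho>\<^sup>2 - 2 * c * \<rho> + 1)))
        / (sqrt pi * Gamma (real d / 2) * (\<rho> - c) * (1 - c * \<rho>))
        * (1 + E i)"
    using x1_pos
  proof eventually_elim
    case (elim i)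
    have "T * Q.corner_term (x1 i) = (xs i powr ((real d - 3) / 2) * (\<rho> / (2 * c)) powr ((real d - 1) / 2)
          * (1 - c\<^sup>2) powr (3 / 2)
          * exp (- (xs i / (2 * (1 - c\<^sup>2))) * (\<rho>\<^sup>2 - 2 * c * \<rho> + 1)))
        / (sqrt pi * Gamma (real d / 2) * (\<rho> - c) * (1 - c * \<rho>))"
    proof -
      have ball: "real (Suc (Suc n)) * unit_ball_vol (real (Suc (Suc n))) = 2 * pi powr (m + 1/2) / Gamma (m + 1/2)"
        "real (Suc n) * unit_ball_vol (real (Suc n)) = 2 * pi powr m / Gamma m"
        using surface_measure_unit_ball[of "real (Suc (Suc n))"] surface_measure_unit_ball[of "real (Suc n)"]
        by (simp_all add: m_def add_divide_distrib add_ac)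
      have half: "- real DIM('a) / 2 = - (m + 1/2)" "real d / 2 = m + 1/2" "(real d - 3) / 2 = m - 1" "(real d - 1) / 2 = m"
        unfolding n d by (simp_all add: m_def field_simps)
      have "T * Q.corner_term (x1 i) = (2 * pi * s1) powr (- (m + 1/2)) * (2 * pi * (s2 - s1)) powr (- (m + 1/2)) *
         (2 * pi powr (m + 1/2) / Gamma (m + 1/2) * (2 * pi powr m / Gamma m)) * (2 powr (m - 1) * Gamma m * k powr (- m)) *
         ((l * (x1 i)\<^sup>2) powr m * exp (- ((x1 i)\<^sup>2 * (1 / s1 + k + k * l\<^sup>2 - 2 * k * l) / 2)) / ((1 / s1 + k - k * l) * (k * l - k) * (x1 i)\<^sup>2))"
        unfolding T_def C_def Q.corner_term_def Q.peak_def Q.A_def Q.B_def Q.kernel_const_def ball half by (rule refl)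
      also have "\<dots> = xs i powr (m - 1) * (\<rho> / (2 * c)) powr m * (1 - c\<^sup>2) powr (3 / 2) * exp (- (xs i / (2 * (1 - c\<^sup>2))) * (\<rho>\<^sup>2 - 2 * c * \<rho> + 1))
          / (sqrt pi * Gamma (m + 1/2) * (\<rho> - c) * (1 - c * \<rho>))"
        unfolding k_def
      proof (rule leading_term_eq[OF s l(1) sl _ elim assms(10) _ assms(11)])
        show "0 < m" by (simp add: m_def)
        show "\<rho> = c * l" using c by (simp add: l_def)
      qed
      finally show ?thesis unfolding half .
    qed
    moreover have "P i = T * Q.corner_term (x1 i) * (1 + E i)"
      using T Q.corner_term_pos[OF elim] by (simp add: E_def)
    ultimately show ?case by simp
  qed
  ultimately show ?thesis unfolding P_def by blast
qed

end
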